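(* Let $\mathcal{E}_n$ be the sequence of experiments based on i.i.d. random variables $(X_1,\dots,X_n)$ with joint distribution $P_{n,\xi_n,\theta_n}$ on the sample space $(\mathcal{X}_n,\mathcal{A}_n)$, where $\xi_n=\xi_0+\delta_1n^{-1/4}$ and $\theta_n=\theta+\delta_2n^{-1/2}$, indexed by $t=(\delta_1^2,\delta_2^\top)^\top\in\mathbb{R}_+\times\mathbb{R}^p$. Suppose that the log-likelihood ratio satisfies $$\log\left(\frac{dP_{n,\xi_n,\theta_n}}{dP_{n,\xi_0,\theta}}\right)=t^\top S_n-\tfrac12t^\top Jt+o_P(1)$$ with the score vector $S_n=(S_{\xi,n},S_{\theta,n}^\top)^\top$ (defined in the context) converging in distribution under the null $P_{n,\xi_0,\theta}$ to $\mathcal{N}(0,J)$, where $J=\begin{pmatrix}J_{\xi\xi}&J_{\xi\theta}\\ J_{\theta\xi}&J_{\theta\theta}\end{pmatrix}$ is non-singular. Then the sequence of experiments $\mathcal{E}_n$ converges to the limit experiment based on observing one sample from $Y=t+v$, where $v\sim\mathcal{N}(0,J^{-1})$. The locally asymptotically optimal statistic for testing $H_0:\delta_1=0$ vs. $H_a:\delta_1\neq0$ is $$Z_n=(J_{\xi\xi}-J_{\xi\theta}J_{\theta\theta}^{-1}J_{\theta\xi})^{-1/2}(S_{\xi,n}-J_{\xi\theta}J_{\theta\theta}^{-1}S_{\theta,n}).$$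
   Context: Setting. $X_1,\dots,X_n$ is a random sample with density $p(x;\xi,\theta)$ with respect to a measure $\mu$; $P_{n,\xi,\theta}$ is the joint distribution (product of $n$ copies of the marginal). $\xi\in\Xi\subset\mathbb{R}$ is the parameter under test with interior null value $\xi_0$; $\theta\in\Theta\subset\mathbb{R}^p$ are nuisance parameters. The density is twice continuously differentiable in $\xi$ and once in $\theta$ for $\mu$-almost all $x$; its first derivative in $\xi$ at $\xi_0$ vanishes almost surely, while its second derivative $\nabla_\xi^2p(x;\xi_0,\theta)$ is, with positive probability, non-zero and, for every $a\in\mathbb{R}^p$, with positive probability not equal to $a^\top\nabla_\theta p(x;\xi_0,\theta)$. Score and information. With $$v_\xi(x)=\frac14\frac{\nabla_\xi^2p(x;\xi_0,\theta)}{\sqrt{p(x;\xi_0,\theta)}}\mathbb{I}_{[p(x;\xi_0,\theta)>0]},\qquad v_\theta(x)=\frac12\frac{\nabla_\theta p(x;\xi_0,\theta)}{\sqrt{p(x;\xi_0,\theta)}}\mathbb{I}_{[p(x;\xi_0,\theta)>0]},$$ put $S_{\xi,n}=\frac{2}{\sqrt n}\sum_i\frac{v_\xi(X_i)}{\sqrt{p(X_i;\xi_0,\theta)}}$, $S_{\theta,n}=\frac{2}{\sqrt n}\sum_i\frac{v_\theta(X_i)}{\sqrt{p(X_i;\xi_0,\theta)}}$, $S_n=(S_{\xi,n},S_{\theta,n}^\top)^\top$, and $J=4\int(v_\xi,v_\theta^\top)^\top(v_\xi,v_\theta^\top)\,d\mu$, partitioned into blocks accordingly. Convergence of experiments. An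 experiment indexed by $H$ is a collection of probability measures $\{P_h:h\in H\}$ on a sample space. A sequence $\mathcal{E}_n=(\mathcal{X}_n,\mathcal{A}_n,P_{n,h}:h\in H)$ converges to a limit experiment $\mathcal{E}=(\mathcal{X},\mathcal{A},P_h:h\in H)$ if the likelihood ratio process $\left(\frac{dP_{n,h}}{dP_{n,h_0}}(X_n)\right)_{h\in I}$ converges in distribution (under $P_{n,h_0}$) to $\left(\frac{dP_h}{dP_{h_0}}(X)\right)_{h\in I}$ (under $P_{h_0}$) for every finite subset $I\subset H$ and every $h_0\in H$. Here $H=\mathbb{R}_+\times\mathbb{R}^p$; for a given $t$, $\delta_1$ is a number whose square is the first coordinate of $t$ (either root). Optimality. Write $Y=(Y_1,Y_2^\top)^\top$ with $Y_1$ scalar. "Locally asymptotically optimal" means that $Z_n$ is the sequence of statistics in the original experiments matched with the optimal test statistic of the limit experiment: in the limit experiment the one-sided test rejecting $H_0$ when $Y_1\ge\Phi^{-1}(1-\alpha)(J_{\xi\xi}-J_{\xi\theta}J_{\theta\theta}^{-1}J_{\theta\xi})^{-1/2}$ is the uniformly most powerful level-$\alpha$ test, and $Z_n$ is matched with the rescaled statistic $(J_{\xi\xi}-J_{\xi\theta}J_{\theta\theta}^{-1}J_{\theta\xi})^{1/2}Y_1$, i.e. for every $t$, $Z_n$ converges in distribution under $P_{n,\xi_n,\theta_n}$ to the law of this variable when $Y\sim\mathcal{N}(t,J^{-1})$. *)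

theory Defs
  imports "HOL-Probability.Probability"
begin

section \<open>Convergence of random elements\<close>

text \<open>
  The portmanteau form is used because HOL-Probability only has weak convergence of measures on
  the real line.  The expectation form also avoids pushing measures forward to
  uncountable products, see the definition of convergence of experiments below.
\<close>

definition conv_in_distr ::
  "(nat \<Rightarrow> 'a measure) \<Rightarrow> (nat \<Rightarrow> 'a \<Rightarrow> 'c::topological_space) \<Rightarrow> 'b measure \<Rightarrow> ('b \<Rightarrow> 'c) \<Rightarrow> bool"
where
  "conv_in_distr P X Q Y \<longleftrightarrow>
     (\<forall>f::'c \<Rightarrow> real. continuous_on UNIV f \<and> bounded (range f) \<longrightarrow>
        (\<lambda>n. \<integral>x. f (X n x) \<partial>P n) \<longlonglongrightarrow> (\<integral>y. f (Y y) \<partial>Q))"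

definition small_o_P_one :: "(nat \<Rightarrow> 'a measure) \<Rightarrow> (nat \<Rightarrow> 'a \<Rightarrow> ereal) \<Rightarrow> bool" where
  "small_o_P_one P R \<longleftrightarrow>
     (\<forall>\<epsilon>>0. (\<lambda>n. measure (P n) {x \<in> space (P n). \<bar>R n x\<bar> > ereal \<epsilon>}) \<longlonglongrightarrow> 0)"

text \<open>Likelihood ratios may vanish, and HOL's \<^term>\<open>ln\<close> satisfies \<^prop>\<open>ln 0 = (0::real)\<close>.\<close>

definition log_ext :: "real \<Rightarrow> ereal" where
  "log_ext x = (if x > 0 then ereal (ln x) else -\<infinity>)"


section \<open>Statistical experiments\<close>

text \<open>
  The density of the absolutely continuous part of \<open>Q\<close> with respect to \<open>P\<close> in the Lebesgue
  decomposition; \<open>RN_deriv\<close> would be identically zero unless \<open>Q\<close> is absolutely continuous.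
  The witness is unique up to a \<open>P\<close>-null set for finite \<open>P\<close> and \<open>Q\<close>.
\<close>

definition likelihood_ratio :: "'a measure \<Rightarrow> 'a measure \<Rightarrow> 'a \<Rightarrow> real" where
  "likelihood_ratio P Q =
     (SOME f. f \<in> borel_measurable P \<and> (\<forall>x. 0 \<le> f x) \<and>
        (\<exists>N\<in>null_sets P. \<forall>A\<in>sets P.
           emeasure Q A = (\<integral>\<^sup>+x\<in>A. ennreal (f x) \<partial>P) + emeasure Q (A \<inter> N)))"

text \<open>
  The process is considered as an element of the function space with the product topology; by
  the restriction to the finite set \<open>I\<close> only its coordinates in \<open>I\<close> matter, so that this is
  convergence in distribution of \<open>I\<close>-indexed random vectors.
\<close>

definition experiments_converge ::
  "'h set \<Rightarrow> (nat \<Rightarrow> 'h \<Rightarrow> 'a measure) \<Rightarrow> ('h \<Rightarrow> 'b measure) \<Rightarrow> bool"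
where
  "experiments_converge H E Q \<longleftrightarrow>
     (\<forall>I h0. finite I \<and> I \<subseteq> H \<and> h0 \<in> H \<longrightarrow>
        conv_in_distr
          (\<lambda>n. E n h0) (\<lambda>n x. \<lambda>h\<in>I. likelihood_ratio (E n h0) (E n h) x)
          (Q h0) (\<lambda>y. \<lambda>h\<in>I. likelihood_ratio (Q h0) (Q h) y))"

text \<open>Randomised tests are represented by their critical functions.\<close>

definition level_test :: "('h \<Rightarrow> 'a measure) \<Rightarrow> 'h set \<Rightarrow> 'h set \<Rightarrow> real \<Rightarrow> ('a \<Rightarrow> real) \<Rightarrow> bool" where
  "level_test Q H0 Ha \<alpha> \<phi> \<longleftrightarrow>
     (\<forall>h\<in>H0 \<union> Ha. \<phi> \<in> borel_measurable (Q h)) \<and>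
     (\<forall>y. 0 \<le> \<phi> y \<and> \<phi> y \<le> 1) \<and>
     (\<forall>h\<in>H0. (\<integral>y. \<phi> y \<partial>Q h) \<le> \<alpha>)"

definition ump_test :: "('h \<Rightarrow> 'a measure) \<Rightarrow> 'h set \<Rightarrow> 'h set \<Rightarrow> real \<Rightarrow> ('a \<Rightarrow> real) \<Rightarrow> bool" where
  "ump_test Q H0 Ha \<alpha> \<phi> \<longleftrightarrow>
     level_test Q H0 Ha \<alpha> \<phi> \<and>
     (\<forall>\<psi>. level_test Q H0 Ha \<alpha> \<psi> \<longrightarrow> (\<forall>h\<in>Ha. (\<integral>y. \<psi> y \<partial>Q h) \<le> (\<integral>y. \<phi> y \<partial>Q h)))"


section \<open>Block vectors and matrices\<close>

text \<open>
  Vectors in \<open>\<real> \<times> \<real>\<^sup>p\<close> are indexed by \<^typ>\<open>'p option\<close>: the coordinate \<^term>\<open>None\<close> belongs to the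
  parameter under test, the coordinates \<^term>\<open>Some i\<close> to the nuisance parameters.
\<close>

definition block_vec :: "real \<Rightarrow> real^'p::finite \<Rightarrow> real^('p option)" where
  "block_vec a b = (\<chi> k. case k of None \<Rightarrow> a | Some i \<Rightarrow> b $ i)"

definition nuisance_part :: "real^('p::finite option) \<Rightarrow> real^'p" where
  "nuisance_part t = (\<chi> i. t $ Some i)"

definition xi_xi :: "real^('p::finite option)^('p option) \<Rightarrow> real" where
  "xi_xi J = J $ None $ None"

definition xi_theta :: "real^('p::finite option)^('p option) \<Rightarrow> real^'p" where
  "xi_theta J = (\<chi> j. J $ None $ Some j)"

definition theta_xi :: "real^('p::finite option)^('p option) \<Rightarrow> real^'p" where
  "theta_xi J = (\<chi> i. J $ Some i $ None)"

definition theta_theta :: "real^('p::finite option)^('p option) \<Rightarrow> real^'p^'p" where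
  "theta_theta J = (\<chi> i j. J $ Some i $ Some j)"

definition efficient_info :: "real^('p::finite option)^('p option) \<Rightarrow> real" where
  "efficient_info J = xi_xi J - xi_theta J \<bullet> (matrix_inv (theta_theta J) *v theta_xi J)"


section \<open>Gaussian laws\<close>

text \<open>The Lebesgue density describes the normal law for positive definite covariance matrices only.\<close>

definition mv_normal :: "real^'k::finite \<Rightarrow> real^'k^'k \<Rightarrow> (real^'k) measure" where
  "mv_normal m \<Sigma> = density lborel (\<lambda>y. ennreal
     (exp (- ((y - m) \<bullet> (matrix_inv \<Sigma> *v (y - m))) / 2) / sqrt ((2 * pi) ^ CARD('k) * det \<Sigma>)))"

definition gaussian_shift :: "real^'k::finite^'k \<Rightarrow> real^'k \<Rightarrow> (real^'k) measure" where
  "gaussian_shift J t = distr (mv_normal 0 (matrix_inv J)) borel (\<lambda>v. t + v)"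

definition normal_quantile :: "real \<Rightarrow> real" where
  "normal_quantile u = inv (cdf std_normal_distribution) u"


section \<open>Sampling model, scores and information\<close>

definition sample_law ::
  "'x measure \<Rightarrow> ('x \<Rightarrow> real \<Rightarrow> real^'p::finite \<Rightarrow> real) \<Rightarrow> nat \<Rightarrow> real \<Rightarrow> real^'p \<Rightarrow> (nat \<Rightarrow> 'x) measure"
where
  "sample_law \<mu> p n \<xi> \<theta> = (\<Pi>\<^sub>M i\<in>{..<n}. density \<mu> (\<lambda>x. ennreal (p x \<xi> \<theta>)))"

text \<open>
  Below, \<open>p0\<close>, \<open>d2\<close> and \<open>g\<close> stand for the density, its second derivative in the parameter under
  test and its gradient in the nuisance parameters, all at the null point, as functions
  of the observation.
\<close>

definition v_xi :: "('x \<Rightarrow> real) \<Rightarrow> ('x \<Rightarrow> real) \<Rightarrow> 'x \<Rightarrow> real" where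
  "v_xi p0 d2 x = 1/4 * (d2 x / sqrt (p0 x)) * indicator {x. p0 x > 0} x"

definition v_theta :: "('x \<Rightarrow> real) \<Rightarrow> ('x \<Rightarrow> real^'p::finite) \<Rightarrow> 'x \<Rightarrow> real^'p" where
  "v_theta p0 g x = (1/2 * (1 / sqrt (p0 x)) * indicator {x. p0 x > 0} x) *\<^sub>R g x"

definition score_xi ::
  "('x \<Rightarrow> real) \<Rightarrow> ('x \<Rightarrow> real) \<Rightarrow> nat \<Rightarrow> (nat \<Rightarrow> 'x) \<Rightarrow> real"
where
  "score_xi p0 d2 n X = 2 / sqrt (real n) * (\<Sum>i<n. v_xi p0 d2 (X i) / sqrt (p0 (X i)))"

definition score_theta ::
  "('x \<Rightarrow> real) \<Rightarrow> ('x \<Rightarrow> real^'p::finite) \<Rightarrow> nat \<Rightarrow> (nat \<Rightarrow> 'x) \<Rightarrow> real^'p"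
where
  "score_theta p0 g n X =
     (2 / sqrt (real n)) *\<^sub>R (\<Sum>i<n. (1 / sqrt (p0 (X i))) *\<^sub>R v_theta p0 g (X i))"

definition info_matrix ::
  "'x measure \<Rightarrow> ('x \<Rightarrow> real) \<Rightarrow> ('x \<Rightarrow> real) \<Rightarrow> ('x \<Rightarrow> real^'p::finite) \<Rightarrow> real^('p option)^('p option)"
where
  "info_matrix \<mu> p0 d2 g =
     (\<chi> k l. 4 * (\<integral>x. block_vec (v_xi p0 d2 x) (v_theta p0 g x) $ k *
                     block_vec (v_xi p0 d2 x) (v_theta p0 g x) $ l \<partial>\<mu>))"

definition efficient_score_stat ::
  "real^('p::finite option)^('p option) \<Rightarrow> real \<Rightarrow> real^'p \<Rightarrow> real"
where
  "efficient_score_stat J a b =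
     efficient_info J powr (-1/2) * (a - xi_theta J \<bullet> (matrix_inv (theta_theta J) *v b))"

end

theory Submission
  imports Defs
begin

text \<open>
  By the expansion, the likelihood ratios with respect to the null are asymptotically the exponentials
  of \<open>t \<bullet> S - t \<bullet> J t / 2\<close>, where \<open>S\<close> is asymptotically \<open>N(0, J)\<close>. These
  exponentials have mean one in the limit, so the likelihood ratios are uniformly integrable and no mass
  of the local alternatives escapes; hence the null can be replaced by any local alternative as the
  dominating law (Le Cam's third lemma). The substitution \<open>s = J y\<close> identifies the tilted limit law
  with the Gaussian shift. In the limit experiment, a shift along the least favourable direction
  multiplies the density by a monotone function of the tested coordinate, which gives both the law of
  this coordinate and, by the Neyman--Pearson argument, the optimality of the half-space test.
\<close>

section \<open>Linear changes of variables\<close>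

text \<open>Absolute continuity is assumed neither between alternatives nor with respect to the
  null, so a likelihood ratio against an alternative is not simply a quotient of ratios against the
  null. The device is to integrate under the null with the truncated weight \<open>min l K\<close>.
  The integrand is then bounded, so weak convergence of the scores applies, and the single defect
  \<open>1 - (\<integral>x. min l K)\<close> bounds both the mass cut off by the truncation and the
  mass of the singular part. The integral of the multivariate normal density is never evaluated.
  Mass one of the limit law \<open>mv_normal 0 J\<close> is extracted from the convergence of the
  scores, carried to all shifts by a linear substitution, and used to fix the constant that
  translation invariance leaves open in the marginal law. Positive definiteness of \<open>J\<close>
  is derived too: \<open>J\<close> is a Gram matrix, and nonsingularity excludes degenerate
  directions.\<close>

lemma nn_integral_lborel_translate:
  fixes f :: "'a::euclidean_space \<Rightarrow> ennreal"
  assumes f: "f \<in> borel_measurable borel"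
  shows "(\<integral>\<^sup>+x. f (x + a) \<partial>lborel) = (\<integral>\<^sup>+x. f x \<partial>lborel)"
proof -
  have "(\<integral>\<^sup>+x. f x \<partial>lborel) = (\<integral>\<^sup>+x. f x \<partial>distr lborel borel ((+) a))"
    by (simp add: lborel_distr_plus)
  also have "\<dots> = (\<integral>\<^sup>+x. f (a + x) \<partial>lborel)"
    using f by (simp add: nn_integral_distr)
  finally show ?thesis by (simp add: add.commute)
qed

text \<open>Uniqueness of Haar measure by Fubini. Insert a function \<open>h\<close> of Lebesgue
  integral one, translate it by \<open>- y\<close>, swap the integrals, translate by
  \<open>x\<close> under \<open>M\<close>, and swap back: the variables separate, and the constant
  is the \<open>M\<close>-integral of \<open>h (- y)\<close>.\<close>

lemma translation_invariant_eq_lborel: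
  fixes M :: "'a::euclidean_space measure"
  assumes "sigma_finite_measure M" and sets_M [measurable_cong]: "sets M = sets borel"
    and invariant: "\<And>a f. f \<in> borel_measurable borel \<Longrightarrow> (\<integral>\<^sup>+x. f (x + a) \<partial>M) = (\<integral>\<^sup>+x. f x \<partial>M)"
  obtains c where "\<And>f. f \<in> borel_measurable borel \<Longrightarrow> (\<integral>\<^sup>+x. f x \<partial>M) = c * (\<integral>\<^sup>+x. f x \<partial>lborel)"
proof -
  interpret M: sigma_finite_measure M by fact
  interpret pair_sigma_finite M "lborel :: 'a measure" ..
  obtain u :: 'a where u: "emeasure lborel (box 0 u) = 1"
  proof
    show "emeasure lborel (box 0 One :: 'a set) = 1"
      by (simp add: emeasure_lborel_box_eq inner_sum_left_Basis)
  qed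
  define h :: "'a \<Rightarrow> ennreal" where "h = indicator (box 0 u)"
  have h [measurable]: "h \<in> borel_measurable borel"
    by (simp add: h_def)
  have "(\<integral>\<^sup>+x. f x \<partial>M) = (\<integral>\<^sup>+y. h (- y) \<partial>M) * (\<integral>\<^sup>+x. f x \<partial>lborel)"
    if f [measurable]: "f \<in> borel_measurable borel" for f
  proof -
    have "(\<integral>\<^sup>+x. f x \<partial>M) = (\<integral>\<^sup>+y. (\<integral>\<^sup>+x. f y * h x \<partial>lborel) \<partial>M)"
      using u by (simp add: nn_integral_cmult h_def)
    also have "\<dots> = (\<integral>\<^sup>+y. (\<integral>\<^sup>+x. f y * h (x + - y) \<partial>lborel) \<partial>M)"
      by (intro nn_integral_cong nn_integral_lborel_translate[symmetric]) measurable
    also have "\<dots> = (\<integral>\<^sup>+x. (\<integral>\<^sup>+y. f y * h (x + - y) \<partial>M) \<partial>lborel)"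
      by (rule Fubini'[symmetric]) measurable
    also have "\<dots> = (\<integral>\<^sup>+x. (\<integral>\<^sup>+y. f (y + x) * h (x + - (y + x)) \<partial>M) \<partial>lborel)"
      by (intro nn_integral_cong invariant[symmetric]) measurable
    also have "\<dots> = (\<integral>\<^sup>+x. (\<integral>\<^sup>+y. f (x + y) * h (- y) \<partial>M) \<partial>lborel)"
      by (simp add: add.commute)
    also have "\<dots> = (\<integral>\<^sup>+y. (\<integral>\<^sup>+x. f (x + y) * h (- y) \<partial>lborel) \<partial>M)"
      by (rule Fubini') measurable
    also have "\<dots> = (\<integral>\<^sup>+y. (\<integral>\<^sup>+x. f x \<partial>lborel) * h (- y) \<partial>M)"
      by (simp add: nn_integral_multc nn_integral_lborel_translate)
    finally show ?thesis
      by (simp add: nn_integral_cmult mult.commute)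
  qed
  then show thesis by (rule that)
qed

lemma borel_measurable_matrix_vector_mult [measurable]:
  fixes A :: "real^'n^'m"
  shows "(*v) A \<in> borel_measurable borel"
  by (intro borel_measurable_continuous_onI linear_continuous_on)
     (simp add: linear_conv_bounded_linear[symmetric])

text \<open>Quantifying over all \<open>f\<close> lets the property compose: in a product of
  matrices, one factor is applied to \<open>f\<close> and the next to \<open>f\<close> composed with
  the first.\<close>

definition linear_change :: "real^'n^'n \<Rightarrow> bool" where
  "linear_change A \<longleftrightarrow> (\<forall>f::real^'n \<Rightarrow> ennreal. f \<in> borel_measurable borel \<longrightarrow>
     (\<integral>\<^sup>+x. f x \<partial>lborel) = ennreal \<bar>det A\<bar> * (\<integral>\<^sup>+x. f (A *v x) \<partial>lborel))"

lemma linear_change_mult: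
  fixes A B :: "real^'n^'n"
  assumes "linear_change A" "linear_change B"
  shows "linear_change (A ** B)"
  unfolding linear_change_def
proof (intro allI impI)
  fix f :: "real^'n \<Rightarrow> ennreal" assume [measurable]: "f \<in> borel_measurable borel"
  have "(\<integral>\<^sup>+x. f x \<partial>lborel) = ennreal \<bar>det A\<bar> * (\<integral>\<^sup>+x. f (A *v x) \<partial>lborel)"
    by (rule assms(1)[unfolded linear_change_def, rule_format]) measurable
  also have "(\<integral>\<^sup>+x. f (A *v x) \<partial>lborel) = ennreal \<bar>det B\<bar> * (\<integral>\<^sup>+x. f (A *v (B *v x)) \<partial>lborel)"
    by (rule assms(2)[unfolded linear_change_def, rule_format]) measurable
  finally show "(\<integral>\<^sup>+x. f x \<partial>lborel) = ennreal \<bar>det (A ** B)\<bar> * (\<integral>\<^sup>+x. f ((A ** B) *v x) \<partial>lborel)"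
    by (simp add: det_mul abs_mult ennreal_mult' matrix_vector_mul_assoc mult.assoc)
qed

lemma linear_change_diagonal:
  fixes A :: "real^'n^'n"
  assumes diag: "\<And>i j. i \<noteq> j \<Longrightarrow> A$i$j = 0" and det: "det A \<noteq> 0"
  shows "linear_change A"
  unfolding linear_change_def
proof (intro allI impI)
  fix f :: "real^'n \<Rightarrow> ennreal" assume [measurable]: "f \<in> borel_measurable borel"
  have det_A: "det A = (\<Prod>i\<in>UNIV. A$i$i)"
    using diag by (rule det_diagonal)
  \<comment> \<open>\<open>lborel_affine_euclidean\<close> indexes the scaling factors by basis
    vectors; on \<open>axis i 1\<close> this expression returns the diagonal entry.\<close>
  define c where "c v = (A *v v) \<bullet> v" for v :: "real^'n"
  have c_axis: "c (axis i 1) = A$i$i" for i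
    by (simp add: c_def inner_axis matrix_vector_mult_basis column_def)
  have Basis: "(Basis :: (real^'n) set) = range (\<lambda>i. axis i 1)"
    by (auto simp: Basis_vec_def)
  have inj: "inj (\<lambda>i. axis i (1::real) :: real^'n)"
    by (auto simp: inj_on_def axis_eq_axis)
  have T: "(\<Sum>j\<in>Basis. (c j * (x \<bullet> j)) *\<^sub>R j) = A *v x" for x
  proof -
    have "(\<Sum>j\<in>Basis. (c j * (x \<bullet> j)) *\<^sub>R j) = (\<Sum>i\<in>UNIV. (A$i$i * x$i) *\<^sub>R axis i 1)"
      unfolding Basis by (subst sum.reindex[OF inj]) (simp add: c_axis inner_axis)
    also have "\<dots> = A *v x"
    proof -
      have "(\<Sum>j\<in>UNIV. A$k$j * x$j) = A$k$k * x$k" for k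
        by (rule trans[OF sum.mono_neutral_right[where S="{k}"]]) (auto simp: diag)
      then show ?thesis
        by (simp add: vec_eq_iff matrix_vector_mult_def axis_def if_distrib cong: if_cong)
    qed
    finally show ?thesis .
  qed
  have prod: "(\<Prod>j\<in>Basis. \<bar>c j\<bar>) = \<bar>det A\<bar>"
    unfolding Basis by (subst prod.reindex[OF inj]) (simp add: c_axis det_A abs_prod)
  have nz: "c j \<noteq> 0" if "j \<in> Basis" for j
    using det that unfolding Basis det_A by (auto simp: c_axis)
  have "lborel = density (distr lborel borel (\<lambda>x. 0 + (\<Sum>j\<in>Basis. (c j * (x \<bullet> j)) *\<^sub>R j)))
      (\<lambda>_. (\<Prod>j\<in>Basis. \<bar>c j\<bar>))"
    by (rule lborel_affine_euclidean) (rule nz)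
  then have L: "lborel = density (distr lborel borel ((*v) A)) (\<lambda>_. ennreal \<bar>det A\<bar>)"
    unfolding T prod by simp
  show "(\<integral>\<^sup>+x. f x \<partial>lborel) = ennreal \<bar>det A\<bar> * (\<integral>\<^sup>+x. f (A *v x) \<partial>lborel)"
    by (subst L) (simp add: nn_integral_density nn_integral_distr nn_integral_cmult)
qed

text \<open>
  The image of \<open>lborel\<close> under an invertible linear map is translation invariant, so the map
  scales volumes by a constant; the square of this constant is \<open>1\<close> for an involution.
\<close>

lemma linear_change_involution:
  fixes A :: "real^'n^'n"
  assumes A: "A ** A = mat 1"
  shows "linear_change A"
proof -
  have AA [simp]: "A *v (A *v x) = x" for x
    by (simp add: matrix_vector_mul_assoc A)
  define M where "M = distr (lborel :: (real^'n) measure) borel ((*v) A)"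
  have sets_M [measurable_cong]: "sets M = sets borel"
    by (simp add: M_def)
  have M: "(\<integral>\<^sup>+x. f x \<partial>M) = (\<integral>\<^sup>+x. f (A *v x) \<partial>lborel)"
    if "f \<in> borel_measurable borel" for f :: "real^'n \<Rightarrow> ennreal"
    unfolding M_def using that by (simp add: nn_integral_distr)
  \<comment> \<open>The exhausting sets are preimages of balls. Pulling such a set back once more
    gives the ball itself, because \<open>A\<close> is its own inverse, so its
    \<open>M\<close>-measure is finite.\<close>
  have "sigma_finite_measure M"
  proof
    let ?C = "range (\<lambda>n::nat. (*v) A -` cball 0 (real n))"
    have "emeasure M ((*v) A -` cball 0 r) < \<infinity>" for r
    proof -
      have [measurable]: "(*v) A -` cball 0 r \<in> sets borel"
        using measurable_sets[OF borel_measurable_matrix_vector_mult, of "cball 0 r" A] by simp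
      have "emeasure M ((*v) A -` cball 0 r) = emeasure lborel (cball (0::real^'n) r)"
        unfolding M_def by (subst emeasure_distr) (auto intro!: arg_cong[where f="emeasure lborel"])
      then show ?thesis
        using emeasure_compact_finite[of "cball (0::real^'n) r"] by simp
    qed
    then have "emeasure M ((*v) A -` cball 0 r) \<noteq> \<top>" for r
      by (simp add: less_top)
    moreover have "\<exists>n::nat. norm (A *v x) \<le> real n" for x
      by (rule real_arch_simple)
    moreover have "(*v) A -` cball 0 r \<in> sets M" for r
      using measurable_sets[OF borel_measurable_matrix_vector_mult, of "cball 0 r" A] by (simp add: sets_M)
    moreover have "space M = UNIV"
      by (simp add: M_def)
    ultimately show "\<exists>C. countable C \<and> C \<subseteq> sets M \<and> \<Union> C = space M \<and> (\<forall>a\<in>C. emeasure M a \<noteq> \<infinity>)"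
      by (intro exI[of _ ?C]) auto
  qed
  then obtain c where c: "\<And>f. f \<in> borel_measurable borel \<Longrightarrow> (\<integral>\<^sup>+x. f x \<partial>M) = c * (\<integral>\<^sup>+x. f x \<partial>lborel)"
  proof (rule translation_invariant_eq_lborel)
    fix a and f :: "real^'n \<Rightarrow> ennreal" assume [measurable]: "f \<in> borel_measurable borel"
    have "(\<integral>\<^sup>+x. f (x + a) \<partial>M) = (\<integral>\<^sup>+x. f (A *v (x + A *v a)) \<partial>lborel)"
      by (simp add: M matrix_vector_right_distrib)
    also have "\<dots> = (\<integral>\<^sup>+x. f x \<partial>M)"
      by (simp add: M nn_integral_lborel_translate[of "\<lambda>x. f (A *v x)"])
    finally show "(\<integral>\<^sup>+x. f (x + a) \<partial>M) = (\<integral>\<^sup>+x. f x \<partial>M)" .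
  qed (simp_all add: sets_M)
  have c': "(\<integral>\<^sup>+x. f (A *v x) \<partial>lborel) = c * (\<integral>\<^sup>+x. f x \<partial>lborel)"
    if "f \<in> borel_measurable borel" for f :: "real^'n \<Rightarrow> ennreal"
    using c[OF that] M[OF that] by simp
  let ?h = "indicator (box 0 One) :: real^'n \<Rightarrow> ennreal"
  have h: "(\<integral>\<^sup>+x. ?h x \<partial>lborel) = 1"
    by (simp add: emeasure_lborel_box_eq inner_sum_left_Basis)
  \<comment> \<open>Scaling the unit box twice returns it unchanged. In \<open>ennreal\<close> this
    leaves only \<open>c = 1\<close>, the value infinity being excluded by the product.\<close>
  have "c * c = c * (\<integral>\<^sup>+x. ?h (A *v x) \<partial>lborel)"
    using c'[of ?h] h by simp
  also have "\<dots> = (\<integral>\<^sup>+x. ?h (A *v (A *v x)) \<partial>lborel)"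
    by (rule c'[symmetric]) measurable
  finally have "c * c = 1"
    using h by simp
  then have "c = 1"
    by (cases c) (auto simp: ennreal_mult[symmetric] ennreal_1[symmetric] square_eq_1_iff
        simp del: ennreal_1 simp: ennreal_top_mult)
  moreover have "det A * det A = 1"
    using A by (metis det_I det_mul)
  then have "\<bar>det A\<bar> = 1"
    by (auto simp: square_eq_1_iff)
  ultimately show ?thesis
    unfolding linear_change_def by (auto simp only: c' ennreal_1 mult_1)
qed

text \<open>Every matrix is built by products from elementary ones. The implication from
  \<open>det A \<noteq> 0\<close> is kept in the induction: it passes to both factors of a product
  and disposes of matrices with a zero row.\<close>

lemma linear_change_of_variables:
  fixes A :: "real^'n^'n" and f :: "real^'n \<Rightarrow> ennreal"
  assumes "det A \<noteq> 0" and f: "f \<in> borel_measurable borel"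
  shows "(\<integral>\<^sup>+x. f x \<partial>lborel) = ennreal \<bar>det A\<bar> * (\<integral>\<^sup>+x. f (A *v x) \<partial>lborel)"
proof -
  have "det A \<noteq> 0 \<longrightarrow> linear_change A"
  proof (induction A rule: induct_matrix_elementary_alt)
    case (1 A B)
    then show ?case by (auto simp: det_mul intro: linear_change_mult)
  next
    case (2 A i)
    then show ?case by (auto dest: det_zero_row)
  next
    case (3 A)
    then show ?case by (auto intro: linear_change_diagonal)
  next
    case (4 m n)
    let ?W = "(\<chi> i j. mat 1 $ i $ Transposition.transpose m n j) :: real^'n^'n"
    have "?W ** ?W = mat 1"
    proof -
      have "(\<Sum>k\<in>UNIV. mat 1 $ i $ Transposition.transpose m n k * mat 1 $ k $ Transposition.transpose m n j)
          = (mat 1 :: real^'n^'n) $ i $ j" for i j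
      proof -
        have "mat 1 $ i $ Transposition.transpose m n k * mat 1 $ k $ Transposition.transpose m n j
          = (if k = Transposition.transpose m n j then mat 1 $ i $ j else (0::real))" for k
          by (auto simp: mat_def)
        then show ?thesis by simp
      qed
      then show ?thesis
        by (simp add: vec_eq_iff matrix_matrix_mult_def)
    qed
    then show ?case by (blast intro: linear_change_involution)
  next
    case (5 m n)
    let ?T = "(\<chi> i j. of_bool (i = m \<and> j = n \<or> i = j)) :: real^'n^'n"
    \<comment> \<open>The shear \<open>?T\<close> is not an involution. Flipping the sign of
      coordinate \<open>m\<close> by \<open>?D\<close> turns it into the involution
      \<open>?T ** ?D\<close>, so \<open>?T\<close> is a product of two involutions.\<close>
    let ?D = "(\<chi> i j. if i = j then if i = m then -1 else 1 else 0) :: real^'n^'n"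
    have DD: "?D ** ?D = mat 1"
      by (simp add: vec_eq_iff matrix_matrix_mult_def mat_def if_distrib[of "\<lambda>x. x * y" for y] cong: if_cong)
    define R :: "real^'n^'n" where "R = ?T ** ?D"
    have R: "R $ i $ j = (if i = m \<and> j = n then 1 else if i = j then if i = m then -1 else 1 else 0)" for i j
      using 5 by (auto simp: R_def matrix_matrix_mult_def if_distrib[of "\<lambda>x. y * x" for y] of_bool_def cong: if_cong)
    have "(\<Sum>k\<in>UNIV. R $ i $ k * R $ k $ j) = (mat 1 :: real^'n^'n) $ i $ j" for i j
    proof (cases "i = m")
      case True
      have "(\<Sum>k\<in>UNIV. R $ i $ k * R $ k $ j) = (\<Sum>k\<in>{m, n}. R $ i $ k * R $ k $ j)"
        by (rule sum.mono_neutral_right) (auto simp: R True)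
      then show ?thesis
        using 5 True by (simp add: R mat_def)
    next
      case False
      have "(\<Sum>k\<in>UNIV. R $ i $ k * R $ k $ j) = (\<Sum>k\<in>{i}. R $ i $ k * R $ k $ j)"
        by (rule sum.mono_neutral_right) (auto simp: R False)
      then show ?thesis
        using False by (simp add: R mat_def)
    qed
    then have "R ** R = mat 1"
      by (simp add: vec_eq_iff matrix_matrix_mult_def)
    then have "linear_change (R ** ?D)"
      by (intro linear_change_mult[OF linear_change_involution linear_change_involution[OF DD]])
    then show ?case
      by (simp add: R_def matrix_mul_assoc[symmetric] DD)
  qed
  then have "linear_change A"
    using assms by simp
  then show ?thesis
    using f unfolding linear_change_def by blast
qed

section \<open>Likelihood ratios\<close>

text \<open>The property by which \<open>likelihood_ratio\<close> chooses its witness, named so that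
  explicit densities can be compared with the chosen one.\<close>

definition is_likelihood_ratio :: "'a measure \<Rightarrow> 'a measure \<Rightarrow> ('a \<Rightarrow> real) \<Rightarrow> bool" where
  "is_likelihood_ratio P Q f \<longleftrightarrow> f \<in> borel_measurable P \<and> (\<forall>x. 0 \<le> f x) \<and>
     (\<exists>N\<in>null_sets P. \<forall>A\<in>sets P.
        emeasure Q A = (\<integral>\<^sup>+x\<in>A. ennreal (f x) \<partial>P) + emeasure Q (A \<inter> N))"

text \<open>Both measures have densities \<open>p\<close> and \<open>q\<close> with respect to their
  sum \<open>T\<close>. The quotient \<open>q / p\<close> is the density of the absolutely
  continuous part, and the singular part lives on the zero set of \<open>p\<close>.\<close>

lemma lebesgue_decomposition_exists:
  assumes "finite_measure P" "finite_measure Q" and sets_Q: "sets Q = sets P"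
  shows "\<exists>f. is_likelihood_ratio P Q f"
proof -
  interpret P: finite_measure P by fact
  interpret Q: finite_measure Q by fact
  note sets_Q [measurable_cong]
  define T where "T = measure_of (space P) (sets P) (\<lambda>A. emeasure P A + emeasure Q A)"
  have sets_T [measurable_cong, simp]: "sets T = sets P"
    by (simp add: T_def)
  then have space_T: "space T = space P"
    by (rule sets_eq_imp_space_eq)
  have T: "emeasure T A = emeasure P A + emeasure Q A" if "A \<in> sets P" for A
    unfolding T_def
  proof (rule emeasure_measure_of_sigma)
    show "sigma_algebra (space P) (sets P)" ..
    show "positive (sets P) (\<lambda>A. emeasure P A + emeasure Q A)"
      by (simp add: positive_def)
    show "countably_additive (sets P) (\<lambda>A. emeasure P A + emeasure Q A)"
      unfolding countably_additive_def
      by (auto simp: suminf_add[symmetric] suminf_emeasure sets_Q)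
  qed fact
  interpret T: finite_measure T
    by (rule finite_measureI)
       (use P.emeasure_finite Q.emeasure_finite in \<open>simp add: space_T T\<close>)
  have "absolutely_continuous T P" "absolutely_continuous T Q"
    by (auto simp: absolutely_continuous_def null_sets_def T sets_Q)
  then obtain p q where [measurable]: "p \<in> borel_measurable T" "q \<in> borel_measurable T"
    and P: "density T p = P" and Q: "density T q = Q"
    using T.Radon_Nikodym_finite_measure[of P] T.Radon_Nikodym_finite_measure[of Q] assms by auto
  have [measurable]: "p \<in> borel_measurable P" "q \<in> borel_measurable P"
    using \<open>p \<in> borel_measurable T\<close> \<open>q \<in> borel_measurable T\<close> by simp_all
  have "emeasure (density T p) (space T) = integral\<^sup>N T p"
    by (subst emeasure_density) (auto simp: space_T intro!: nn_integral_cong)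
  then have "integral\<^sup>N T p = emeasure P (space P)"
    by (simp add: P space_T)
  then have p_fin: "AE x in T. p x \<noteq> \<infinity>"
    by (intro nn_integral_noteq_infinite) (simp_all add: P.emeasure_finite)
  have "emeasure (density T q) (space T) = integral\<^sup>N T q"
    by (subst emeasure_density) (auto simp: space_T intro!: nn_integral_cong)
  then have "integral\<^sup>N T q = emeasure Q (space P)"
    by (simp add: Q space_T)
  then have q_fin: "AE x in T. q x \<noteq> \<infinity>"
    by (intro nn_integral_noteq_infinite) (simp_all add: Q.emeasure_finite)
  define N where "N = {x \<in> space P. p x = 0}"
  have N [measurable]: "N \<in> sets P"
    unfolding N_def by measurable
  define f where "f x = enn2real (q x / p x)" for x
  have f [measurable]: "f \<in> borel_measurable P"
    unfolding f_def by measurable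
  have "emeasure P N = (\<integral>\<^sup>+x. p x * indicator N x \<partial>T)"
    by (subst P[symmetric]) (simp add: emeasure_density)
  also have "\<dots> = 0"
    by (rule nn_integral_0_iff_AE[THEN iffD2]) (auto simp: N_def split: split_indicator)
  finally have "N \<in> null_sets P"
    by auto
  moreover have "emeasure Q A = (\<integral>\<^sup>+x\<in>A. ennreal (f x) \<partial>P) + emeasure Q (A \<inter> N)" if [measurable]: "A \<in> sets P" for A
  proof -
    have "emeasure Q (A - N) = (\<integral>\<^sup>+x. q x * indicator (A - N) x \<partial>T)"
      by (subst Q[symmetric]) (simp add: emeasure_density)
    also have "\<dots> = (\<integral>\<^sup>+x. p x * (ennreal (f x) * indicator A x) \<partial>T)"
    proof (rule nn_integral_cong_AE)
      show "AE x in T. q x * indicator (A - N) x = p x * (ennreal (f x) * indicator A x)"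
        using p_fin q_fin
      proof (eventually_elim)
        fix x assume fin: "p x \<noteq> \<infinity>" "q x \<noteq> \<infinity>"
        show "q x * indicator (A - N) x = p x * (ennreal (f x) * indicator A x)"
        proof (cases "x \<in> A \<and> p x \<noteq> 0")
          case True
          then have "q x / p x < \<top>"
            using True fin by (auto simp: ennreal_divide_eq_top_iff simp flip: less_top)
          then have "ennreal (f x) = q x / p x"
            by (simp add: f_def)
          then show ?thesis
            using True fin by (simp add: N_def ennreal_times_divide ennreal_mult_divide_eq mult.commute[of "p x"])
        next
          case False
          then show ?thesis
            using sets.sets_into_space[OF \<open>A \<in> sets P\<close>] by (auto simp: N_def split: split_indicator)
        qed
      qed
    qed
    also have "\<dots> = (\<integral>\<^sup>+x\<in>A. ennreal (f x) \<partial>P)"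
      by (subst P[symmetric]) (simp add: nn_integral_density)
    finally have "emeasure Q (A - N) = (\<integral>\<^sup>+x\<in>A. ennreal (f x) \<partial>P)" .
    moreover have "emeasure Q A = emeasure Q (A - N) + emeasure Q (A \<inter> N)"
      by (subst plus_emeasure) (auto simp: sets_Q intro!: arg_cong[where f="emeasure Q"])
    ultimately show ?thesis by simp
  qed
  moreover have "\<forall>x. 0 \<le> f x"
    by (simp add: f_def)
  ultimately show ?thesis
    unfolding is_likelihood_ratio_def using f by blast
qed

lemma likelihood_ratio:
  assumes "finite_measure P" "finite_measure Q" "sets Q = sets P"
  shows "is_likelihood_ratio P Q (likelihood_ratio P Q)"
  using someI_ex[OF lebesgue_decomposition_exists[OF assms]]
  unfolding is_likelihood_ratio_def likelihood_ratio_def .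

text \<open>Only an inequality, since the singular part of \<open>Q\<close> is dropped. It replaces
  the change of measure formula in the third lemma.\<close>

lemma is_likelihood_ratio_nn_integral_le:
  assumes f: "is_likelihood_ratio P Q f" and sets_Q: "sets Q = sets P"
    and g: "g \<in> borel_measurable P"
  shows "(\<integral>\<^sup>+x. ennreal (f x) * g x \<partial>P) \<le> (\<integral>\<^sup>+x. g x \<partial>Q)"
proof -
  have [measurable]: "f \<in> borel_measurable P" using f by (simp add: is_likelihood_ratio_def)
  have "(\<integral>\<^sup>+x. ennreal (f x) * g x \<partial>P) = (\<integral>\<^sup>+x. g x \<partial>density P (\<lambda>x. ennreal (f x)))"
    using g by (simp add: nn_integral_density)
  also have "\<dots> \<le> (\<integral>\<^sup>+x. g x \<partial>Q)"
  proof (rule nn_integral_mono_measure)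
    have "emeasure (density P (\<lambda>x. ennreal (f x))) A \<le> emeasure Q A" for A
    proof (cases "A \<in> sets P")
      case True
      obtain N where "\<forall>A\<in>sets P. emeasure Q A = (\<integral>\<^sup>+x\<in>A. ennreal (f x) \<partial>P) + emeasure Q (A \<inter> N)"
        using f by (auto simp: is_likelihood_ratio_def)
      then show ?thesis
        using True by (auto simp: emeasure_density)
    qed (simp add: emeasure_notin_sets sets_Q)
    then show "density P (\<lambda>x. ennreal (f x)) \<le> Q"
      using sets_eq_imp_space_eq[OF sets_Q] by (simp add: le_measure_iff sets_Q le_fun_def)
  qed (simp add: sets_Q)
  finally show ?thesis .
qed

text \<open>
  On the event where \<open>Q0\<close> has a vanishing density, \<open>r\<close> is arbitrary from the point
  of view of \<open>P\<close>.
\<close>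

lemma likelihood_ratio_chain:
  assumes "finite_measure P" "sets Q0 = sets P" "sets Q1 = sets P"
    and f0: "is_likelihood_ratio P Q0 f0" and f1: "is_likelihood_ratio P Q1 f1"
    and r: "is_likelihood_ratio Q0 Q1 r"
  shows "AE x in P. 0 < f0 x \<longrightarrow> r x * f0 x = f1 x"
proof -
  interpret finite_measure P by fact
  note sets[measurable_cong, simp] = \<open>sets Q0 = sets P\<close> \<open>sets Q1 = sets P\<close>
  have [measurable]: "f0 \<in> borel_measurable P" "f1 \<in> borel_measurable P" "r \<in> borel_measurable P"
    and nonneg: "0 \<le> f0 x" "0 \<le> f1 x" "0 \<le> r x" for x
    using f0 f1 r by (auto simp: is_likelihood_ratio_def)
  obtain N0 where N0: "N0 \<in> null_sets P"
    and Q0: "\<And>A. A \<in> sets P \<Longrightarrow> emeasure Q0 A = (\<integral>\<^sup>+x\<in>A. ennreal (f0 x) \<partial>P) + emeasure Q0 (A \<inter> N0)"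
    using f0 by (auto simp: is_likelihood_ratio_def)
  obtain N1 where N1: "N1 \<in> null_sets P"
    and Q1: "\<And>A. A \<in> sets P \<Longrightarrow> emeasure Q1 A = (\<integral>\<^sup>+x\<in>A. ennreal (f1 x) \<partial>P) + emeasure Q1 (A \<inter> N1)"
    using f1 by (auto simp: is_likelihood_ratio_def)
  obtain M where M: "M \<in> null_sets Q0"
    and R: "\<And>A. A \<in> sets P \<Longrightarrow> emeasure Q1 A = (\<integral>\<^sup>+x\<in>A. ennreal (r x) \<partial>Q0) + emeasure Q1 (A \<inter> M)"
    using r by (auto simp: is_likelihood_ratio_def)
  have [measurable]: "N0 \<in> sets P" "N1 \<in> sets P" "M \<in> sets P"
    using N0 N1 M by auto
  \<comment> \<open>On subsets of \<open>B\<close> none of the three decompositions has a singular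
    contribution.\<close>
  define B where "B = {x \<in> space P. 0 < f0 x} - N0 - N1 - M"
  have [measurable]: "B \<in> sets P"
    unfolding B_def by measurable
  \<comment> \<open>\<open>M\<close> is null for \<open>Q0\<close>, hence \<open>f0\<close> vanishes
    almost everywhere on \<open>M\<close> under \<open>P\<close>. So \<open>B\<close> loses only a
    null set of the points where \<open>f0\<close> is positive.\<close>
  have "(\<integral>\<^sup>+x\<in>M. ennreal (f0 x) \<partial>P) = 0"
    using Q0[of M] M by auto
  then have "AE x in P. ennreal (f0 x) * indicator M x = 0"
    by (subst (asm) nn_integral_0_iff_AE) auto
  moreover have "AE x in P. x \<notin> N0" "AE x in P. x \<notin> N1"
    using N0 N1 by (auto intro: AE_not_in)
  ultimately have AE_B: "AE x in P. 0 < f0 x \<longrightarrow> x \<in> B"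
    using AE_space by eventually_elim (auto simp: B_def indicator_def split: if_splits)
  have density_Q0: "density Q0 (indicator B) = density P (\<lambda>x. ennreal (f0 x) * indicator B x)"
  proof (rule measure_eqI)
    fix A assume "A \<in> sets (density Q0 (indicator B))"
    then have [measurable]: "A \<in> sets P" by simp
    have "emeasure (density Q0 (indicator B)) A = emeasure Q0 (A \<inter> B)"
      by (simp add: emeasure_density indicator_inter_arith[symmetric] Int_commute)
    also have "\<dots> = (\<integral>\<^sup>+x\<in>A \<inter> B. ennreal (f0 x) \<partial>P)"
      by (subst Q0) (auto simp: B_def intro!: arg_cong[where f="emeasure Q0", of _ "{}", simplified])
    also have "\<dots> = emeasure (density P (\<lambda>x. ennreal (f0 x) * indicator B x)) A"
      by (simp add: emeasure_density indicator_inter_arith ac_simps)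
    finally show "emeasure (density Q0 (indicator B)) A = emeasure (density P (\<lambda>x. ennreal (f0 x) * indicator B x)) A" .
  qed simp
  have "AE x in P. ennreal (r x * f0 x) * indicator B x = ennreal (f1 x) * indicator B x"
  proof (rule density_unique_finite_measure)
    fix A assume [measurable]: "A \<in> sets P"
    have "(\<integral>\<^sup>+x. ennreal (r x * f0 x) * indicator B x * indicator A x \<partial>P)
      = (\<integral>\<^sup>+x. (ennreal (f0 x) * indicator B x) * (ennreal (r x) * indicator A x) \<partial>P)"
      by (intro nn_integral_cong) (simp add: ennreal_mult' nonneg ac_simps)
    also have "\<dots> = (\<integral>\<^sup>+x. ennreal (r x) * indicator A x \<partial>density Q0 (indicator B))"
      by (simp add: density_Q0 nn_integral_density)
    also have "\<dots> = (\<integral>\<^sup>+x\<in>A \<inter> B. ennreal (r x) \<partial>Q0)"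
      by (simp add: nn_integral_density indicator_inter_arith ac_simps)
    also have "\<dots> = emeasure Q1 (A \<inter> B)"
      by (subst R) (auto simp: B_def intro!: arg_cong[where f="emeasure Q1", of _ "{}", simplified])
    also have "\<dots> = (\<integral>\<^sup>+x\<in>A \<inter> B. ennreal (f1 x) \<partial>P)"
      by (subst Q1) (auto simp: B_def intro!: arg_cong[where f="emeasure Q1", of _ "{}", simplified])
    finally show "(\<integral>\<^sup>+x. ennreal (r x * f0 x) * indicator B x * indicator A x \<partial>P)
      = (\<integral>\<^sup>+x. ennreal (f1 x) * indicator B x * indicator A x \<partial>P)"
      by (simp add: indicator_inter_arith ac_simps)
  qed auto
  with AE_B show ?thesis
    by eventually_elim (auto simp: nonneg ennreal_inj)
qed

lemma is_likelihood_ratio_density: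
  assumes "f \<in> borel_measurable P" "\<And>x. 0 \<le> f x"
  shows "is_likelihood_ratio P (density P (\<lambda>x. ennreal (f x))) f"
  unfolding is_likelihood_ratio_def using assms
  by (auto intro!: bexI[of _ "{}"] simp: emeasure_density)

lemma is_likelihood_ratio_refl: "is_likelihood_ratio P P (\<lambda>_. 1)"
  using is_likelihood_ratio_density[of "\<lambda>_. 1" P] by (simp add: density_1)

text \<open>The chain rule with intermediate measure \<open>P\<close> itself, whose ratio is
  constantly one.\<close>

lemma is_likelihood_ratio_unique:
  assumes "finite_measure P" "sets Q = sets P" "is_likelihood_ratio P Q f" "is_likelihood_ratio P Q g"
  shows "AE x in P. f x = g x"
  using likelihood_ratio_chain[OF assms(1) refl assms(2) is_likelihood_ratio_refl assms(4,3)] by simp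

section \<open>Le Cam's third lemma\<close>

text \<open>A basic open set of the product topology restricts only finitely many coordinates, so
  one radius serves them all. This turns a uniform bound on the remainders into membership in a
  neighbourhood of zero.\<close>

lemma open_fun_contains_box:
  fixes U :: "('h \<Rightarrow> real) set"
  assumes "open U" "(\<lambda>_. 0) \<in> U"
  obtains \<delta> where "\<delta> > 0" "\<And>r. (\<And>h. \<bar>r h\<bar> \<le> \<delta>) \<Longrightarrow> r \<in> U"
proof -
  have "openin (product_topology (\<lambda>_. euclidean) UNIV) U"
    using assms(1) by (simp add: open_fun_def)
  from product_topology_open_contains_basis[OF this assms(2)]
  obtain X where X: "(\<lambda>_. 0) \<in> (\<Pi>\<^sub>E i\<in>UNIV. X i)" "\<And>i. open (X i)"
    "finite {i. X i \<noteq> UNIV}" "(\<Pi>\<^sub>E i\<in>UNIV. X i) \<subseteq> U"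
    by auto
  have "\<exists>e>0. \<forall>y. \<bar>y\<bar> \<le> e \<longrightarrow> y \<in> X i" for i
  proof -
    have "0 \<in> X i" using X(1) by auto
    then obtain e where "e > 0" "cball 0 e \<subseteq> X i"
      using X(2) open_contains_cball by blast
    then show ?thesis
      by (intro exI[of _ e]) (auto simp: subset_eq)
  qed
  then obtain e where e: "\<And>i. e i > 0" "\<And>i y. \<bar>y\<bar> \<le> e i \<Longrightarrow> y \<in> X i"
    by metis
  \<comment> \<open>The element \<open>1\<close> keeps the minimum defined when no coordinate is
    restricted.\<close>
  define \<delta> where "\<delta> = Min (insert 1 (e ` {i. X i \<noteq> UNIV}))"
  show thesis
  proof
    show "\<delta> > 0"
      unfolding \<delta>_def using X(3) e(1) by (subst Min_gr_iff) auto
    fix r :: "'h \<Rightarrow> real" assume r: "\<And>h. \<bar>r h\<bar> \<le> \<delta>"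
    have "r i \<in> X i" for i
    proof (cases "X i = UNIV")
      case False
      then have "\<delta> \<le> e i"
        unfolding \<delta>_def using X(3) by (intro Min_le) auto
      then show ?thesis
        using r[of i] by (intro e(2)) auto
    qed auto
    then show "r \<in> U"
      using X(4) by (auto simp: PiE_UNIV_domain)
  qed
qed

text \<open>The index type \<open>'h\<close> may be uncountable, where Borel and product
  sigma-algebras of the function space differ. Only the finitely many coordinates in
  \<open>I\<close> matter, so the process is renumbered and routed through
  \<open>nat \<Rightarrow> real\<close>, where coordinatewise measurability suffices.\<close>

lemma borel_measurable_continuous_process:
  fixes \<Phi> :: "('h \<Rightarrow> real) \<times> 'c::euclidean_space \<Rightarrow> real"
  assumes \<Phi>: "continuous_on UNIV \<Phi>" and "finite I"
    and f: "\<And>h. h \<in> I \<Longrightarrow> f h \<in> borel_measurable M" and S [measurable]: "S \<in> borel_measurable M"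
  shows "(\<lambda>x. \<Phi> (\<lambda>h\<in>I. f h x, S x)) \<in> borel_measurable M"
proof -
  obtain i where i: "bij_betw i I {..<card I}"
    using \<open>finite I\<close> ex_bij_betw_finite_nat[of I] by (auto simp: atLeast0LessThan)
  define j where "j = inv_into I i"
  have ij: "j (i h) = h" "i h < card I" if "h \<in> I" for h
    using i that by (auto simp: j_def bij_betw_def)
  have j: "j k \<in> I" if "k < card I" for k
    using i that by (auto simp: j_def bij_betw_def intro!: inv_into_into)
  define g where "g x = (\<lambda>k. if k < card I then f (j k) x else 0)" for x
  have [measurable]: "g \<in> borel_measurable M"
  proof (rule measurable_coordinatewise_then_product)
    show "(\<lambda>x. g x k) \<in> borel_measurable M" for k
      using f[OF j, of k] by (cases "k < card I") (simp_all add: g_def)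
  qed
  have pair: "(\<lambda>x. (g x, S x)) \<in> borel_measurable M"
    by measurable
  have "continuous_on UNIV (\<lambda>y :: (nat \<Rightarrow> real) \<times> 'c. \<Phi> (\<lambda>h\<in>I. fst y (i h), snd y))"
  proof (rule continuous_on_compose2[OF \<Phi>])
    have "continuous_on UNIV (\<lambda>y :: (nat \<Rightarrow> real) \<times> 'c. fst y k)" for k
      by (rule continuous_on_product_then_coordinatewise) (intro continuous_intros)
    then have "continuous_on UNIV (\<lambda>y :: (nat \<Rightarrow> real) \<times> 'c. (\<lambda>h\<in>I. fst y (i h)) h)" for h
      by (cases "h \<in> I") simp_all
    then show "continuous_on UNIV (\<lambda>y :: (nat \<Rightarrow> real) \<times> 'c. (\<lambda>h\<in>I. fst y (i h), snd y))"
      by (intro continuous_on_Pair continuous_on_coordinatewise_then_product continuous_intros)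
  qed auto
  then have G: "(\<lambda>y :: (nat \<Rightarrow> real) \<times> 'c. \<Phi> (\<lambda>h\<in>I. fst y (i h), snd y)) \<in> borel_measurable borel"
    by (rule borel_measurable_continuous_onI)
  have "(\<lambda>x. \<Phi> (\<lambda>h\<in>I. g x (i h), S x)) \<in> borel_measurable M"
    using measurable_compose[OF pair G] by simp
  moreover have "(\<lambda>h\<in>I. g x (i h)) = (\<lambda>h\<in>I. f h x)" for x
    by (auto simp: g_def ij)
  ultimately show ?thesis by simp
qed

text \<open>
  Outside events of vanishing probability, \<open>T n\<close> is a continuous function of \<open>S n\<close> and of a
  uniformly small remainder \<open>R n\<close>; the latter may be replaced by zero because \<open>S n\<close> is tight.
\<close>

lemma slutsky_process:
  fixes S :: "nat \<Rightarrow> 'a \<Rightarrow> 'c::euclidean_space" and T :: "nat \<Rightarrow> 'a \<Rightarrow> real"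
    and R :: "nat \<Rightarrow> 'a \<Rightarrow> 'h \<Rightarrow> real" and \<Psi> :: "('h \<Rightarrow> real) \<times> 'c \<Rightarrow> real"
  assumes P: "\<forall>\<^sub>F n in sequentially. prob_space (P n)"
    and S: "\<forall>\<^sub>F n in sequentially. S n \<in> borel_measurable (P n)"
    and T: "\<forall>\<^sub>F n in sequentially. T n \<in> borel_measurable (P n)"
    and conv: "conv_in_distr P S Q (\<lambda>y. y)"
    and Q: "prob_space Q" "sets Q = sets borel"
    and \<Psi>: "continuous_on UNIV \<Psi>" and \<Psi>_bound: "\<And>z. \<bar>\<Psi> z\<bar> \<le> C"
    and T_bound: "\<And>n x. \<bar>T n x\<bar> \<le> C"
    and B_sets: "\<And>\<delta>. \<delta> > 0 \<Longrightarrow> \<forall>\<^sub>F n in sequentially. B \<delta> n \<in> sets (P n)"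
    and B_null: "\<And>\<delta>. \<delta> > 0 \<Longrightarrow> (\<lambda>n. measure (P n) (B \<delta> n)) \<longlonglongrightarrow> 0"
    and T_eq: "\<And>\<delta> n x. \<delta> > 0 \<Longrightarrow> x \<in> space (P n) - B \<delta> n \<Longrightarrow> T n x = \<Psi> (R n x, S n x)"
    and R_small: "\<And>\<delta> n x h. \<delta> > 0 \<Longrightarrow> x \<in> space (P n) - B \<delta> n \<Longrightarrow> \<bar>R n x h\<bar> \<le> \<delta>"
  shows "(\<lambda>n. \<integral>x. T n x \<partial>P n) \<longlonglongrightarrow> (\<integral>s. \<Psi> (\<lambda>_. 0, s) \<partial>Q)"
proof -
  interpret Q: prob_space Q by fact
  note Q(2) [measurable_cong]
  define F where "F s = \<Psi> (\<lambda>_. 0, s)" for s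
  have F: "continuous_on UNIV F"
    unfolding F_def by (rule continuous_on_compose2[OF \<Psi>]) (auto intro!: continuous_intros)
  have F_bound: "\<bar>F s\<bar> \<le> C" for s
    by (simp add: F_def \<Psi>_bound)
  then have "C \<ge> 0" by (meson abs_ge_zero order_trans)
  have [measurable]: "F \<in> borel_measurable borel"
    using F by (rule borel_measurable_continuous_onI)
  \<comment> \<open>A continuous substitute for the indicator of a large norm, rising from 0 to 1
    between radii \<open>K\<close> and \<open>K + 1\<close>; an indicator could not be used as a
    test function for weak convergence.\<close>
  define \<tau> where "\<tau> K s = min 1 (max 0 (norm s - K))" for K :: real and s :: 'c
  have \<tau>_cont: "continuous_on UNIV (\<tau> K)" for K
    unfolding \<tau>_def by (intro continuous_intros)
  then have \<tau>_meas [measurable]: "\<tau> K \<in> borel_measurable borel" for K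
    by (rule borel_measurable_continuous_onI)
  have \<tau>_range: "0 \<le> \<tau> K s" "\<tau> K s \<le> 1" for K s
    by (auto simp: \<tau>_def)
  have \<tau>_conv: "(\<lambda>n. \<integral>x. \<tau> K (S n x) \<partial>P n) \<longlonglongrightarrow> (\<integral>s. \<tau> K s \<partial>Q)" for K
  proof -
    have "bounded (range (\<tau> K))"
      using \<tau>_range by (intro boundedI[where B=1]) auto
    then show ?thesis
      using conv \<tau>_cont unfolding conv_in_distr_def by blast
  qed
  have \<tau>_tight: "(\<lambda>k. \<integral>s. \<tau> (real k) s \<partial>Q) \<longlonglongrightarrow> (\<integral>s. 0 \<partial>Q)"
  proof (rule integral_dominated_convergence[where w="\<lambda>_. 1"])
    show "AE s in Q. (\<lambda>k. \<tau> (real k) s) \<longlonglongrightarrow> 0"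
    proof (rule AE_I2)
      fix s :: 'c
      obtain k0 where "norm s \<le> real k0" using real_arch_simple by blast
      then have "\<forall>k\<ge>k0. \<tau> (real k) s = 0"
        by (auto simp: \<tau>_def)
      then show "(\<lambda>k. \<tau> (real k) s) \<longlonglongrightarrow> 0"
        by (intro tendsto_eventually eventually_sequentiallyI) auto
    qed
  qed (use \<tau>_range in auto)
  have "(\<lambda>n. (\<integral>x. T n x \<partial>P n) - (\<integral>x. F (S n x) \<partial>P n)) \<longlonglongrightarrow> 0"
  proof (rule tendstoI)
    fix \<epsilon> :: real assume "\<epsilon> > 0"
    \<comment> \<open>The total error will be
      \<open>\<eta> + 2 * C * \<eta> + 2 * C * \<eta>\<close>; the summand 2 leaves strict slack and
      keeps the denominator positive for \<open>C = 0\<close>.\<close>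
    define \<eta> where "\<eta> = \<epsilon> / (2 + 4 * C)"
    have \<eta>: "\<eta> > 0"
      using \<open>\<epsilon> > 0\<close> \<open>C \<ge> 0\<close> by (simp add: \<eta>_def)
    have "\<forall>\<^sub>F k in sequentially. (\<integral>s. \<tau> (real k) s \<partial>Q) < \<eta>"
      using \<tau>_tight \<eta> by (auto dest: order_tendstoD)
    then obtain k where k: "(\<integral>s. \<tau> (real k) s \<partial>Q) < \<eta>"
      by (auto simp: eventually_sequentially)
    \<comment> \<open>Compactness of the ball gives one neighbourhood of the zero remainder that
      works for all scores in it. The radius is \<open>real k + 1\<close> because the cutoff equals
      one beyond it.\<close>
    have "continuous_on (UNIV \<times> cball 0 (real k + 1)) \<Psi>"
      using \<Psi> by (rule continuous_on_subset) simp
    then obtain U where U: "(\<lambda>_. 0) \<in> U" "open U"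
      "\<forall>r\<in>U \<inter> UNIV. \<forall>s\<in>cball 0 (real k + 1). dist (\<Psi> (r, s)) (\<Psi> (\<lambda>_. 0, s)) \<le> \<eta>"
      by (rule continuous_on_prod_compactE[OF _ compact_cball UNIV_I \<eta>])
    obtain \<delta> where \<delta>: "\<delta> > 0" "\<And>r. (\<And>h. \<bar>r h\<bar> \<le> \<delta>) \<Longrightarrow> r \<in> U"
      using open_fun_contains_box[OF U(2,1)] by blast
    have "\<forall>\<^sub>F n in sequentially. measure (P n) (B \<delta> n) < \<eta>"
      using B_null[OF \<delta>(1)] \<eta> by (auto dest: order_tendstoD)
    moreover have "\<forall>\<^sub>F n in sequentially. (\<integral>x. \<tau> (real k) (S n x) \<partial>P n) < \<eta>"
      using \<tau>_conv k by (auto dest: order_tendstoD)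
    ultimately show "\<forall>\<^sub>F n in sequentially. dist ((\<integral>x. T n x \<partial>P n) - (\<integral>x. F (S n x) \<partial>P n)) 0 < \<epsilon>"
      using P S T B_sets[OF \<delta>(1)]
    proof eventually_elim
      fix n assume B: "measure (P n) (B \<delta> n) < \<eta>" and \<tau>: "(\<integral>x. \<tau> (real k) (S n x) \<partial>P n) < \<eta>"
        and "prob_space (P n)"
        and [measurable]: "S n \<in> borel_measurable (P n)" "T n \<in> borel_measurable (P n)" "B \<delta> n \<in> sets (P n)"
      interpret prob_space "P n" by fact
      have int: "integrable (P n) (\<lambda>x. T n x)" "integrable (P n) (\<lambda>x. F (S n x))"
        "integrable (P n) (\<lambda>x. \<tau> (real k) (S n x))"
        by (rule integrable_const_bound[where B="max 1 C"]; auto simp: T_bound F_bound \<tau>_range le_max_iff_disj)+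
      have intB: "integrable (P n) (indicator (B \<delta> n) :: _ \<Rightarrow> real)"
        by (rule integrable_const_bound[where B=1]) (auto simp: indicator_def)
      have "\<bar>T n x - F (S n x)\<bar> \<le> \<eta> + 2 * C * \<tau> (real k) (S n x) + 2 * C * indicator (B \<delta> n) x"
        if x: "x \<in> space (P n)" for x
      proof -
        have le: "\<bar>T n x - F (S n x)\<bar> \<le> 2 * C"
          using T_bound[of n x] F_bound[of "S n x"] by linarith
        have nn: "0 \<le> 2 * C * \<tau> (real k) (S n x)" "0 \<le> 2 * C * (indicator (B \<delta> n) x :: real)"
          using \<open>C \<ge> 0\<close> \<tau>_range by auto
        consider "x \<in> B \<delta> n" | "norm (S n x) > real k + 1" | "x \<notin> B \<delta> n" "norm (S n x) \<le> real k + 1"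
          by linarith
        then show ?thesis
        proof cases
          case 1
          then have "2 * C * (indicator (B \<delta> n) x :: real) = 2 * C" by simp
          then show ?thesis using le nn \<eta> by linarith
        next
          case 2
          then have "\<tau> (real k) (S n x) = 1" by (simp add: \<tau>_def)
          then have "2 * C * \<tau> (real k) (S n x) = 2 * C" by simp
          then show ?thesis using le nn \<eta> by linarith
        next
          case 3
          then have "dist (\<Psi> (R n x, S n x)) (\<Psi> (\<lambda>_. 0, S n x)) \<le> \<eta>"
            using x U(3) \<delta>(2)[of "R n x"] R_small[OF \<delta>(1), of x n] by auto
          then show ?thesis
            using T_eq[OF \<delta>(1), of x n] x 3 nn by (simp add: F_def dist_real_def)
        qed
      qed
      then have "(\<integral>x. \<bar>T n x - F (S n x)\<bar> \<partial>P n)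
          \<le> (\<integral>x. \<eta> + 2 * C * \<tau> (real k) (S n x) + 2 * C * indicator (B \<delta> n) x \<partial>P n)"
        using int intB by (intro integral_mono) auto
      also have "\<dots> = \<eta> + 2 * C * (\<integral>x. \<tau> (real k) (S n x) \<partial>P n) + 2 * C * prob (B \<delta> n)"
        using int intB by (simp add: prob_space)
      also have "\<dots> \<le> \<eta> + 2 * C * \<eta> + 2 * C * \<eta>"
        using \<tau> B \<open>C \<ge> 0\<close> by (intro add_mono mult_left_mono) auto
      also have "\<dots> < (2 + 4 * C) * \<eta>"
        using \<eta> by (simp add: algebra_simps)
      also have "\<dots> = \<epsilon>"
        using \<open>C \<ge> 0\<close> by (simp add: \<eta>_def)
      finally have "\<bar>\<integral>x. T n x - F (S n x) \<partial>P n\<bar> < \<epsilon>"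
        using integral_abs_bound[of "P n" "\<lambda>x. T n x - F (S n x)"] by linarith
      then show "dist ((\<integral>x. T n x \<partial>P n) - (\<integral>x. F (S n x) \<partial>P n)) 0 < \<epsilon>"
        using int by simp
    qed
  qed
  moreover have "(\<lambda>n. \<integral>x. F (S n x) \<partial>P n) \<longlonglongrightarrow> (\<integral>s. F s \<partial>Q)"
  proof -
    have "bounded (range F)"
      using F_bound by (intro boundedI[where B=C]) auto
    then show ?thesis
      using conv F unfolding conv_in_distr_def by blast
  qed
  ultimately show ?thesis
    using tendsto_add by (fastforce simp: F_def)
qed

text \<open>\<open>A h\<close> is the limiting log-likelihood ratio as a function of the score. The
  assumption \<open>mass\<close> is the contiguity condition of Le Cam's first lemma. The laws need
  to be probability measures only eventually, since early local parameters may leave the parameter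
  set.\<close>

locale log_likelihood_expansion =
  fixes H :: "'h set" and P :: "nat \<Rightarrow> 'a measure" and E :: "nat \<Rightarrow> 'h \<Rightarrow> 'a measure"
    and S :: "nat \<Rightarrow> 'a \<Rightarrow> 'c::euclidean_space" and A :: "'h \<Rightarrow> 'c \<Rightarrow> real" and N :: "'c measure"
  assumes prob_P: "\<forall>\<^sub>F n in sequentially. prob_space (P n)"
    and prob_E: "h \<in> H \<Longrightarrow> \<forall>\<^sub>F n in sequentially. prob_space (E n h) \<and> sets (E n h) = sets (P n)"
    and S: "\<forall>\<^sub>F n in sequentially. S n \<in> borel_measurable (P n)"
    and A: "h \<in> H \<Longrightarrow> continuous_on UNIV (A h)"
    and expansion: "h \<in> H \<Longrightarrow>
      small_o_P_one P (\<lambda>n x. log_ext (likelihood_ratio (P n) (E n h) x) - ereal (A h (S n x)))"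
    and conv: "conv_in_distr P S N (\<lambda>y. y)"
    and prob_N: "prob_space N" and sets_N: "sets N = sets borel"
    and mass: "h \<in> H \<Longrightarrow> (\<integral>\<^sup>+s. ennreal (exp (A h s)) \<partial>N) = 1"
begin

text \<open>A nonpositive \<open>l\<close> has \<open>log_ext l = -\<infinity>\<close> and hence
  infinite error, so a finite error forces positivity.\<close>

lemma log_ext_error:
  assumes "\<not> \<bar>log_ext l - ereal a\<bar> > ereal \<delta>"
  shows "l > 0" "\<bar>ln l - a\<bar> \<le> \<delta>"
  using assms by (auto simp: log_ext_def not_less split: if_splits)

text \<open>The weight is cut at \<open>K\<close> so that the integrand is bounded and
  \<open>slutsky_process\<close> applies. The \<open>max 0\<close> keeps the bound valid also for
  those \<open>n\<close> for which \<open>likelihood_ratio\<close> is not known to be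
  nonnegative.\<close>

lemma truncated_limit:
  fixes \<Phi> :: "('h \<Rightarrow> real) \<times> 'c \<Rightarrow> real"
  assumes I: "finite I" "I \<subseteq> H" and h0: "h0 \<in> H"
    and \<Phi>: "continuous_on UNIV \<Phi>" and \<Phi>_bound: "\<And>z. \<bar>\<Phi> z\<bar> \<le> C" and "K > 0"
  defines "l \<equiv> \<lambda>n h. likelihood_ratio (P n) (E n h)"
  shows "(\<lambda>n. \<integral>x. \<Phi> (\<lambda>h\<in>I. l n h x / l n h0 x, S n x) * min (max 0 (l n h0 x)) K \<partial>P n) \<longlonglongrightarrow>
    (\<integral>s. \<Phi> (\<lambda>h\<in>I. exp (A h s - A h0 s), s) * min (exp (A h0 s)) K \<partial>N)"
proof -
  \<comment> \<open>The integrand with every ratio written as \<open>exp\<close> of its limit plus a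
    remainder; the first component of \<open>z\<close> carries the remainders, and at zero it gives
    the claimed limit.\<close>
  define \<Psi> where "\<Psi> z = \<Phi> (\<lambda>h\<in>I. exp (A h (snd z) - A h0 (snd z) + fst z h - fst z h0), snd z)
    * min (exp (A h0 (snd z) + fst z h0)) K" for z :: "('h \<Rightarrow> real) \<times> 'c"
  \<comment> \<open>The default 0 makes the uniform bound hold at every index, also outside
    \<open>I\<close> where nothing is known.\<close>
  define R where "R n x h = (if h \<in> insert h0 I \<and> l n h x > 0 then ln (l n h x) - A h (S n x) else 0)" for n x h
  define D where "D \<delta> n h = {x \<in> space (P n). \<bar>log_ext (l n h x) - ereal (A h (S n x))\<bar> > ereal \<delta>}" for \<delta> n h
  define B where "B \<delta> n = (\<Union>h\<in>insert h0 I. D \<delta> n h)" for \<delta> n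
  have fin: "finite (insert h0 I)" and sub: "insert h0 I \<subseteq> H"
    using I h0 by auto
  have l_meas: "\<forall>\<^sub>F n in sequentially. l n h \<in> borel_measurable (P n)" if "h \<in> H" for h
    using prob_P prob_E[OF that]
  proof eventually_elim
    case (elim n)
    then show ?case
      using likelihood_ratio[of "P n" "E n h"]
      by (auto simp: l_def is_likelihood_ratio_def prob_space_def)
  qed
  have l_meas_all: "\<forall>\<^sub>F n in sequentially. \<forall>h\<in>insert h0 I. l n h \<in> borel_measurable (P n)"
    using l_meas sub by (intro eventually_ball_finite[OF fin]) auto
  have A_meas: "A h \<in> borel_measurable borel" if "h \<in> H" for h
    using A[OF that] by (rule borel_measurable_continuous_onI)
  have D_sets: "\<forall>\<^sub>F n in sequentially. \<forall>h\<in>insert h0 I. D \<delta> n h \<in> sets (P n)" for \<delta>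
    using l_meas_all S
  proof eventually_elim
    fix n assume l: "\<forall>h\<in>insert h0 I. l n h \<in> borel_measurable (P n)" and [measurable]: "S n \<in> borel_measurable (P n)"
    show "\<forall>h\<in>insert h0 I. D \<delta> n h \<in> sets (P n)"
    proof
      fix h assume h: "h \<in> insert h0 I"
      have [measurable]: "l n h \<in> borel_measurable (P n)" "A h \<in> borel_measurable borel"
        using l h sub by (auto intro!: A_meas)
      show "D \<delta> n h \<in> sets (P n)"
        unfolding D_def log_ext_def by measurable
    qed
  qed
  have "(\<lambda>n. \<integral>x. \<Phi> (\<lambda>h\<in>I. l n h x / l n h0 x, S n x) * min (max 0 (l n h0 x)) K \<partial>P n)
      \<longlonglongrightarrow> (\<integral>s. \<Psi> (\<lambda>_. 0, s) \<partial>N)"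
  proof (rule slutsky_process[where R=R and B=B and C="C * K", OF prob_P S _ conv prob_N sets_N])
    show "\<forall>\<^sub>F n in sequentially. (\<lambda>x. \<Phi> (\<lambda>h\<in>I. l n h x / l n h0 x, S n x) * min (max 0 (l n h0 x)) K)
        \<in> borel_measurable (P n)"
      using l_meas_all S
    proof eventually_elim
      fix n assume l: "\<forall>h\<in>insert h0 I. l n h \<in> borel_measurable (P n)" and [measurable]: "S n \<in> borel_measurable (P n)"
      have [measurable]: "l n h0 \<in> borel_measurable (P n)"
        using l by auto
      have [measurable]: "(\<lambda>x. \<Phi> (\<lambda>h\<in>I. l n h x / l n h0 x, S n x)) \<in> borel_measurable (P n)"
        using l by (intro borel_measurable_continuous_process[OF \<Phi> I(1)] borel_measurable_divide) auto
      show "(\<lambda>x. \<Phi> (\<lambda>h\<in>I. l n h x / l n h0 x, S n x) * min (max 0 (l n h0 x)) K) \<in> borel_measurable (P n)"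
        by measurable
    qed
    have coord: "continuous_on UNIV (\<lambda>z :: ('h \<Rightarrow> real) \<times> 'c. fst z h)" for h
      by (rule continuous_on_product_then_coordinatewise) (intro continuous_intros)
    have A_cont: "continuous_on UNIV (\<lambda>z :: ('h \<Rightarrow> real) \<times> 'c. A h (snd z))" if "h \<in> H" for h
      by (rule continuous_on_compose2[OF A[OF that]]) (auto intro: continuous_intros)
    have "continuous_on UNIV (\<lambda>z. (\<lambda>h\<in>I. exp (A h (snd z) - A h0 (snd z) + fst z h - fst z h0)) h)" for h
      using I(2) by (cases "h \<in> I") (auto intro!: continuous_intros A_cont coord h0)
    then have "continuous_on UNIV
        (\<lambda>z. \<Phi> (\<lambda>h\<in>I. exp (A h (snd z) - A h0 (snd z) + fst z h - fst z h0), snd z))"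
      by (intro continuous_on_compose2[OF \<Phi>] continuous_on_Pair
          continuous_on_coordinatewise_then_product continuous_intros) auto
    then show "continuous_on UNIV \<Psi>"
      unfolding \<Psi>_def by (intro continuous_intros A_cont coord h0)
    have "C \<ge> 0"
      using \<Phi>_bound[of undefined] by linarith
    have bound: "\<bar>\<Phi> z * min y K\<bar> \<le> C * K" if "y \<ge> 0" for z y
      unfolding abs_mult using \<open>K > 0\<close> that \<open>C \<ge> 0\<close> by (intro mult_mono \<Phi>_bound) auto
    show "\<bar>\<Psi> z\<bar> \<le> C * K" for z
      unfolding \<Psi>_def by (rule bound) simp
    show "\<bar>\<Phi> (\<lambda>h\<in>I. l n h x / l n h0 x, S n x) * min (max 0 (l n h0 x)) K\<bar> \<le> C * K" for n x
      by (rule bound) simp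
    show "\<forall>\<^sub>F n in sequentially. B \<delta> n \<in> sets (P n)" for \<delta>
      using D_sets[of \<delta>] by eventually_elim (use I in \<open>auto simp: B_def\<close>)
    show "(\<lambda>n. measure (P n) (B \<delta> n)) \<longlonglongrightarrow> 0" if "\<delta> > 0" for \<delta>
    proof (rule tendsto_sandwich)
      show "\<forall>\<^sub>F n in sequentially. 0 \<le> measure (P n) (B \<delta> n)" by simp
      show "\<forall>\<^sub>F n in sequentially. measure (P n) (B \<delta> n) \<le> (\<Sum>h\<in>insert h0 I. measure (P n) (D \<delta> n h))"
        using prob_P D_sets[of \<delta>]
      proof eventually_elim
        case (elim n)
        then interpret prob_space "P n" by simp
        show ?case
          unfolding B_def using elim fin by (intro finite_measure_subadditive_finite) auto
      qed
      have "(\<lambda>n. measure (P n) (D \<delta> n h)) \<longlonglongrightarrow> 0" if "h \<in> insert h0 I" for h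
        using expansion[of h] that sub \<open>\<delta> > 0\<close> unfolding small_o_P_one_def D_def l_def by blast
      then show "(\<lambda>n. \<Sum>h\<in>insert h0 I. measure (P n) (D \<delta> n h)) \<longlonglongrightarrow> 0"
        by (intro tendsto_null_sum)
    qed auto
    show "\<bar>R n x h\<bar> \<le> \<delta>" if "\<delta> > 0" "x \<in> space (P n) - B \<delta> n" for \<delta> n x h
      using that log_ext_error(2)[of \<delta> "l n h x" "A h (S n x)"]
      by (auto simp: R_def B_def D_def)
    show "\<Phi> (\<lambda>h\<in>I. l n h x / l n h0 x, S n x) * min (max 0 (l n h0 x)) K = \<Psi> (R n x, S n x)"
      if "\<delta> > 0" "x \<in> space (P n) - B \<delta> n" for \<delta> n x
    proof -
      have pos: "l n h x > 0" if "h \<in> insert h0 I" for h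
        using \<open>x \<in> space (P n) - B \<delta> n\<close> that
        by (intro log_ext_error(1)[of \<delta> "l n h x" "A h (S n x)"]) (auto simp: B_def D_def)
      then have eq: "l n h x = exp (A h (S n x) + R n x h)" if "h \<in> insert h0 I" for h
        using that by (auto simp: R_def)
      have "(\<lambda>h\<in>I. l n h x / l n h0 x) = (\<lambda>h\<in>I. exp (A h (S n x) - A h0 (S n x) + R n x h - R n x h0))"
      proof
        fix h
        show "(\<lambda>h\<in>I. l n h x / l n h0 x) h = (\<lambda>h\<in>I. exp (A h (S n x) - A h0 (S n x) + R n x h - R n x h0)) h"
          using eq[of h] eq[of h0] by (simp add: exp_add exp_diff)
      qed
      moreover have "max 0 (l n h0 x) = exp (A h0 (S n x) + R n x h0)"
        using eq[of h0] pos[of h0] by simp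
      ultimately show ?thesis
        by (simp add: \<Psi>_def)
    qed
  qed
  then show ?thesis
    by (simp add: \<Psi>_def cong: restrict_cong)
qed

text \<open>Where the null ratio \<open>l n h0\<close> is positive, ratios against
  \<open>E n h0\<close> are quotients of ratios against the null; elsewhere the weight vanishes.
  Truncation costs at most \<open>C\<close> times the missing mass, which is small because the
  limiting mass is one. Ratios and score appear jointly in \<open>\<Phi>\<close>, so the lemma
  yields both convergence of experiments and, with \<open>I\<close> empty, limit laws of
  statistics.\<close>

lemma le_cam_third:
  fixes \<Phi> :: "('h \<Rightarrow> real) \<times> 'c \<Rightarrow> real"
  assumes I: "finite I" "I \<subseteq> H" and h0: "h0 \<in> H"
    and \<Phi>: "continuous_on UNIV \<Phi>" and \<Phi>_bound: "\<And>z. \<bar>\<Phi> z\<bar> \<le> C"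
  shows "(\<lambda>n. \<integral>x. \<Phi> (\<lambda>h\<in>I. likelihood_ratio (E n h0) (E n h) x, S n x) \<partial>E n h0) \<longlonglongrightarrow>
    (\<integral>s. \<Phi> (\<lambda>h\<in>I. exp (A h s - A h0 s), s) * exp (A h0 s) \<partial>N)"
proof -
  interpret N: prob_space N by (rule prob_N)
  note sets_N [measurable_cong]
  have "C \<ge> 0"
    using \<Phi>_bound[of undefined] by linarith
  have A_meas: "A h \<in> borel_measurable borel" if "h \<in> H" for h
    using A[OF that] by (rule borel_measurable_continuous_onI)
  note [measurable] = A_meas[OF h0]
  define l where "l n h = likelihood_ratio (P n) (E n h)" for n h
  define U where "U n x = \<Phi> (\<lambda>h\<in>I. likelihood_ratio (E n h0) (E n h) x, S n x)" for n x
  define V where "V n x = \<Phi> (\<lambda>h\<in>I. l n h x / l n h0 x, S n x)" for n x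
  define W where "W s = \<Phi> (\<lambda>h\<in>I. exp (A h s - A h0 s), s)" for s
  have W_meas [measurable]: "W \<in> borel_measurable borel"
    unfolding W_def
  proof (rule borel_measurable_continuous_process[OF \<Phi> I(1)])
    fix h assume "h \<in> I"
    then have [measurable]: "A h \<in> borel_measurable borel"
      using I(2) A_meas by auto
    show "(\<lambda>s. exp (A h s - A h0 s)) \<in> borel_measurable borel"
      by measurable
  qed measurable
  have W_bound: "\<bar>W s\<bar> \<le> C" for s
    by (simp add: W_def \<Phi>_bound)
  \<comment> \<open>The mass that survives truncation at \<open>K\<close> in the limit; it tends to
    one by dominated convergence.\<close>
  define m where "m K = (\<integral>s. min (exp (A h0 s)) K \<partial>N)" for K
  have int_exp: "integrable N (\<lambda>s. exp (A h0 s))"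
    using mass[OF h0] by (intro integrableI_nonneg) (auto simp: sets_N)
  have exp_mass: "(\<integral>s. exp (A h0 s) \<partial>N) = 1"
    using mass[OF h0] by (simp add: integral_eq_nn_integral sets_N)
  have int_min: "integrable N (\<lambda>s. min (exp (A h0 s)) K)" if "K > 0" for K
    using that by (intro N.integrable_const_bound[where B=K]) auto
  have int_W: "integrable N (\<lambda>s. W s * exp (A h0 s))"
  proof (rule Bochner_Integration.integrable_bound)
    show "integrable N (\<lambda>s. C * exp (A h0 s))" using int_exp by simp
    show "AE s in N. norm (W s * exp (A h0 s)) \<le> norm (C * exp (A h0 s))"
      using W_bound \<open>C \<ge> 0\<close> by (auto simp: abs_mult)
  qed measurable
  have int_W_min: "integrable N (\<lambda>s. W s * min (exp (A h0 s)) K)" if "K > 0" for K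
  proof (rule Bochner_Integration.integrable_bound)
    show "integrable N (\<lambda>s. C * min (exp (A h0 s)) K)" using int_min[OF that] by simp
    show "AE s in N. norm (W s * min (exp (A h0 s)) K) \<le> norm (C * min (exp (A h0 s)) K)"
      using W_bound \<open>C \<ge> 0\<close> by (auto simp: abs_mult intro!: mult_right_mono)
  qed measurable
  have limit_error: "\<bar>(\<integral>s. W s * min (exp (A h0 s)) K \<partial>N) - (\<integral>s. W s * exp (A h0 s) \<partial>N)\<bar> \<le> C * (1 - m K)"
    if K: "K > 0" for K
  proof -
    have "\<bar>(\<integral>s. W s * min (exp (A h0 s)) K \<partial>N) - (\<integral>s. W s * exp (A h0 s) \<partial>N)\<bar>
      = \<bar>\<integral>s. W s * min (exp (A h0 s)) K - W s * exp (A h0 s) \<partial>N\<bar>"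
      using int_W int_W_min[OF K] by simp
    also have "\<dots> \<le> (\<integral>s. \<bar>W s * min (exp (A h0 s)) K - W s * exp (A h0 s)\<bar> \<partial>N)"
      by (rule integral_abs_bound)
    also have "\<dots> \<le> (\<integral>s. C * (exp (A h0 s) - min (exp (A h0 s)) K) \<partial>N)"
    proof (rule integral_mono)
      fix s
      have "\<bar>W s * min (exp (A h0 s)) K - W s * exp (A h0 s)\<bar> = \<bar>W s\<bar> * (exp (A h0 s) - min (exp (A h0 s)) K)"
        unfolding right_diff_distrib[symmetric] abs_mult by simp
      also have "\<dots> \<le> C * (exp (A h0 s) - min (exp (A h0 s)) K)"
        using W_bound by (intro mult_right_mono) auto
      finally show "\<bar>W s * min (exp (A h0 s)) K - W s * exp (A h0 s)\<bar> \<le> C * (exp (A h0 s) - min (exp (A h0 s)) K)" .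
    qed (use int_W int_W_min[OF K] int_exp int_min[OF K] in auto)
    also have "\<dots> = C * (1 - m K)"
      using int_exp int_min[OF K] by (simp add: exp_mass m_def)
    finally show ?thesis .
  qed
  have m_limit: "(\<lambda>k. m (real (Suc k))) \<longlonglongrightarrow> 1"
    unfolding exp_mass[symmetric] m_def
  proof (rule integral_dominated_convergence[where w="\<lambda>s. exp (A h0 s)"])
    show "AE s in N. (\<lambda>k. min (exp (A h0 s)) (real (Suc k))) \<longlonglongrightarrow> exp (A h0 s)"
    proof (rule AE_I2)
      fix s
      obtain k0 where "exp (A h0 s) \<le> real k0" using real_arch_simple by blast
      then have "\<forall>k\<ge>k0. min (exp (A h0 s)) (real (Suc k)) = exp (A h0 s)"
        by auto
      then show "(\<lambda>k. min (exp (A h0 s)) (real (Suc k))) \<longlonglongrightarrow> exp (A h0 s)"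
        by (intro tendsto_eventually eventually_sequentiallyI) auto
    qed
  qed (use int_exp in auto)
  text \<open>The truncated law \<open>min l K \<cdot> P n\<close> is dominated by \<open>E n h0\<close>, whose total mass is one.\<close>
  have truncation_error: "\<forall>\<^sub>F n in sequentially.
      \<bar>(\<integral>x. U n x \<partial>E n h0) - (\<integral>x. V n x * min (max 0 (l n h0 x)) K \<partial>P n)\<bar>
        \<le> C * (1 - (\<integral>x. min (max 0 (l n h0 x)) K \<partial>P n))" if K: "K > 0" for K
  proof -
    have "\<forall>\<^sub>F n in sequentially. \<forall>h\<in>insert h0 I. prob_space (E n h) \<and> sets (E n h) = sets (P n)"
      using I h0 prob_E by (intro eventually_ball_finite) auto
    with prob_P S show ?thesis
    proof eventually_elim
      fix n assume "prob_space (P n)" and [measurable]: "S n \<in> borel_measurable (P n)"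
        and *: "\<forall>h\<in>insert h0 I. prob_space (E n h) \<and> sets (E n h) = sets (P n)"
      interpret P: prob_space "P n" by fact
      interpret E: prob_space "E n h0" using * by simp
      have sets_E [measurable_cong]: "sets (E n h0) = sets (P n)" using * by simp
      have lr: "is_likelihood_ratio (P n) (E n h) (l n h)"
        and lr0: "is_likelihood_ratio (E n h0) (E n h) (likelihood_ratio (E n h0) (E n h))"
        if "h \<in> insert h0 I" for h
        unfolding l_def using * that
        by (auto intro!: likelihood_ratio prob_space.finite_measure P.finite_measure_axioms E.finite_measure_axioms)
      have l_meas: "l n h \<in> borel_measurable (P n)" and l_nonneg: "0 \<le> l n h x"
        if "h \<in> insert h0 I" for h x
        using lr[OF that] by (auto simp: is_likelihood_ratio_def)
      note [measurable] = l_meas[OF insertI1]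
      have max_l [simp]: "max 0 (l n h0 x) = l n h0 x" for x
        using l_nonneg[of h0 x] by simp
      have r_meas: "likelihood_ratio (E n h0) (E n h) \<in> borel_measurable (P n)" if "h \<in> I" for h
        using lr0[of h] that sets_E by (auto simp: is_likelihood_ratio_def cong: measurable_cong_sets)
      have U_meas [measurable]: "U n \<in> borel_measurable (P n)"
        unfolding U_def by (rule borel_measurable_continuous_process[OF \<Phi> I(1)]) (auto intro: r_meas)
      have V_meas [measurable]: "V n \<in> borel_measurable (P n)"
        unfolding V_def
        by (rule borel_measurable_continuous_process[OF \<Phi> I(1)])
           (auto intro!: borel_measurable_divide l_meas)
      have "AE x in P n. \<forall>h\<in>I. 0 < l n h0 x \<longrightarrow> likelihood_ratio (E n h0) (E n h) x * l n h0 x = l n h x"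
        using * I(1) by (intro AE_finite_allI likelihood_ratio_chain[OF P.finite_measure_axioms _ _ lr lr lr0]) auto
      then have UV: "AE x in P n. V n x * min (l n h0 x) K = U n x * min (l n h0 x) K"
      proof eventually_elim
        fix x assume x: "\<forall>h\<in>I. 0 < l n h0 x \<longrightarrow> likelihood_ratio (E n h0) (E n h) x * l n h0 x = l n h x"
        show "V n x * min (l n h0 x) K = U n x * min (l n h0 x) K"
        proof (cases "l n h0 x = 0")
          case False
          then have "0 < l n h0 x" using l_nonneg[of h0 x] by simp
          then have "(\<lambda>h\<in>I. l n h x / l n h0 x) = (\<lambda>h\<in>I. likelihood_ratio (E n h0) (E n h) x)"
            using x by (auto simp: restrict_def fun_eq_iff field_simps)
          then show ?thesis by (simp add: U_def V_def)
        qed (use K in simp)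
      qed
      have int_min: "integrable (P n) (\<lambda>x. min (l n h0 x) K)"
        using K l_nonneg[of h0] by (intro P.integrable_const_bound[where B=K]) auto
      have U_bound: "\<bar>U n x\<bar> \<le> C" for x
        by (simp add: U_def \<Phi>_bound)
      have int_UP: "integrable (P n) (\<lambda>x. U n x * min (l n h0 x) K)"
      proof (rule P.integrable_const_bound[where B="C * K"])
        show "AE x in P n. norm (U n x * min (l n h0 x) K) \<le> C * K"
          unfolding real_norm_def abs_mult using K l_nonneg[of h0] U_bound \<open>C \<ge> 0\<close>
          by (intro AE_I2 mult_mono) auto
      qed measurable
      have int_UE: "integrable (E n h0) (U n)"
        using U_bound by (intro E.integrable_const_bound[where B=C]) auto
      \<comment> \<open>Domination compares nonnegative functions only, so \<open>C\<close> is added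
        to \<open>U\<close>. The two signs of \<open>\<sigma>\<close> give the upper and the lower
        bound.\<close>
      have le: "(\<integral>x. (C + \<sigma> * U n x) * min (l n h0 x) K \<partial>P n) \<le> (\<integral>x. C + \<sigma> * U n x \<partial>E n h0)"
        if \<sigma>: "\<bar>\<sigma>\<bar> = 1" for \<sigma> :: real
      proof -
        have nonneg: "0 \<le> C + \<sigma> * U n x" for x
          using U_bound[of x] \<sigma> by (auto simp: abs_if split: if_splits)
        have int1: "integrable (P n) (\<lambda>x. (C + \<sigma> * U n x) * min (l n h0 x) K)"
          using int_UP int_min by (simp add: distrib_right mult.assoc)
        have int2: "integrable (E n h0) (\<lambda>x. C + \<sigma> * U n x)"
          using int_UE by simp
        have "ennreal (\<integral>x. (C + \<sigma> * U n x) * min (l n h0 x) K \<partial>P n)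
          = (\<integral>\<^sup>+x. ennreal ((C + \<sigma> * U n x) * min (l n h0 x) K) \<partial>P n)"
          using nonneg K l_nonneg[of h0] by (intro nn_integral_eq_integral[symmetric] int1) auto
        also have "\<dots> \<le> (\<integral>\<^sup>+x. ennreal (l n h0 x) * ennreal (C + \<sigma> * U n x) \<partial>P n)"
          using nonneg K l_nonneg[of h0]
          by (intro nn_integral_mono) (auto simp: ennreal_mult'[symmetric] mult.commute intro!: ennreal_leI mult_right_mono)
        also have "\<dots> \<le> (\<integral>\<^sup>+x. ennreal (C + \<sigma> * U n x) \<partial>E n h0)"
          by (rule is_likelihood_ratio_nn_integral_le[OF lr[OF insertI1] sets_E]) measurable
        also have "\<dots> = ennreal (\<integral>x. C + \<sigma> * U n x \<partial>E n h0)"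
          using nonneg by (intro nn_integral_eq_integral int2) auto
        finally show ?thesis
          using nonneg by (subst (asm) ennreal_le_iff) (auto intro!: integral_nonneg_AE)
      qed
      have expand: "C * (\<integral>x. min (l n h0 x) K \<partial>P n) + \<sigma> * (\<integral>x. U n x * min (l n h0 x) K \<partial>P n)
          \<le> C + \<sigma> * (\<integral>x. U n x \<partial>E n h0)" if "\<bar>\<sigma>\<bar> = 1" for \<sigma>
        using le[OF that] int_UP int_min int_UE by (simp add: distrib_right mult.assoc E.prob_space)
      have "(\<integral>x. V n x * min (l n h0 x) K \<partial>P n) = (\<integral>x. U n x * min (l n h0 x) K \<partial>P n)"
        by (rule integral_cong_AE) (use UV in auto)
      then show "\<bar>(\<integral>x. U n x \<partial>E n h0) - (\<integral>x. V n x * min (max 0 (l n h0 x)) K \<partial>P n)\<bar>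
        \<le> C * (1 - (\<integral>x. min (max 0 (l n h0 x)) K \<partial>P n))"
        using expand[of 1] expand[of "-1"] by (simp add: algebra_simps abs_le_iff)
    qed
  qed
  have "(\<lambda>n. \<integral>x. U n x \<partial>E n h0) \<longlonglongrightarrow> (\<integral>s. W s * exp (A h0 s) \<partial>N)"
  proof (rule tendstoI)
    fix \<epsilon> :: real assume "\<epsilon> > 0"
    \<comment> \<open>Three errors occur: truncation before the limit, truncation in the limit, and
      convergence at fixed \<open>K\<close>. Each stays below a quarter of
      \<open>\<epsilon>\<close>.\<close>
    define \<eta> where "\<eta> = \<epsilon> / (4 * (C + 1))"
    have \<eta>: "\<eta> > 0" "C * \<eta> < \<epsilon> / 4"
      using \<open>\<epsilon> > 0\<close> \<open>C \<ge> 0\<close> by (auto simp: \<eta>_def field_simps)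
    have "\<forall>\<^sub>F k in sequentially. m (real (Suc k)) > 1 - \<eta>"
      using m_limit \<eta> by (intro order_tendstoD) auto
    then obtain k where k: "m (real (Suc k)) > 1 - \<eta>"
      by (auto simp: eventually_sequentially)
    define K where "K = real (Suc k)"
    have K: "K > 0" "m K > 1 - \<eta>"
      using k by (auto simp: K_def)
    \<comment> \<open>With no ratios and a constant function, the truncated limit is the convergence
      of the retained masses, which makes the defect small uniformly in large
      \<open>n\<close>.\<close>
    have "(\<lambda>n. \<integral>x. min (max 0 (l n h0 x)) K \<partial>P n) \<longlonglongrightarrow> m K"
      using truncated_limit[of "{}" h0 "\<lambda>_. 1" 1 K] h0 K by (simp add: l_def m_def)
    then have "\<forall>\<^sub>F n in sequentially. (\<integral>x. min (max 0 (l n h0 x)) K \<partial>P n) > 1 - \<eta>"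
      using K by (intro order_tendstoD)
    moreover have "(\<lambda>n. \<integral>x. V n x * min (max 0 (l n h0 x)) K \<partial>P n) \<longlonglongrightarrow> (\<integral>s. W s * min (exp (A h0 s)) K \<partial>N)"
      unfolding V_def W_def l_def by (rule truncated_limit[OF I h0 \<Phi> \<Phi>_bound K(1)])
    then have "\<forall>\<^sub>F n in sequentially.
        dist (\<integral>x. V n x * min (max 0 (l n h0 x)) K \<partial>P n) (\<integral>s. W s * min (exp (A h0 s)) K \<partial>N) < \<epsilon> / 4"
      using \<open>\<epsilon> > 0\<close> by (intro tendstoD) auto
    ultimately show "\<forall>\<^sub>F n in sequentially. dist (\<integral>x. U n x \<partial>E n h0) (\<integral>s. W s * exp (A h0 s) \<partial>N) < \<epsilon>"
      using truncation_error[OF K(1)]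
    proof eventually_elim
      case (elim n)
      have "C * (1 - (\<integral>x. min (max 0 (l n h0 x)) K \<partial>P n)) \<le> C * \<eta>" "C * (1 - m K) \<le> C * \<eta>"
        using elim(1) K(2) \<open>C \<ge> 0\<close> by (auto intro!: mult_left_mono)
      then show ?case
        using elim(2,3) limit_error[OF K(1)] \<eta>(2) unfolding dist_real_def by linarith
    qed
  qed
  then show ?thesis
    by (simp add: U_def W_def)
qed

end

section \<open>Gaussian shift experiments\<close>

lemma matrix_inv:
  fixes A :: "real^'n^'n"
  assumes "invertible A"
  shows "A ** matrix_inv A = mat 1" "matrix_inv A ** A = mat 1"
  using someI_ex[OF assms[unfolded invertible_def]] unfolding matrix_inv_def by auto

lemma matrix_inv_unique:
  fixes A B :: "real^'n^'n"
  assumes "A ** B = mat 1"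
  shows "matrix_inv A = B"
proof -
  have "invertible A"
    using assms invertible_right_inverse by blast
  then have "matrix_inv A ** (A ** B) = B"
    by (simp add: matrix_mul_assoc matrix_inv)
  then show ?thesis
    by (simp add: assms)
qed

lemma symmetric_dot:
  fixes A :: "real^'n^'n"
  assumes "transpose A = A"
  shows "x \<bullet> (A *v y) = (A *v x) \<bullet> y"
  by (metis assms dot_lmul_matrix transpose_matrix_vector)

text \<open>Mass one is assumed for the law with covariance \<open>J\<close>, that of the scores;
  for the shifts, with covariance \<open>matrix_inv J\<close>, it is derived by
  substitution.\<close>

locale gaussian_shift_experiment =
  fixes J :: "real^'n^'n"
  assumes sym: "transpose J = J" and inv: "invertible J" and prob: "prob_space (mv_normal 0 J)"
begin

definition loglik :: "real^'n \<Rightarrow> real^'n \<Rightarrow> real" where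
  "loglik t s = t \<bullet> s - 1/2 * (t \<bullet> (J *v t))"

definition normalizer :: real where
  "normalizer = sqrt ((2 * pi) ^ CARD('n) * det (matrix_inv J))"

definition quad :: "real^'n \<Rightarrow> real" where
  "quad y = y \<bullet> (J *v y)"

lemma inv_mult [simp]: "matrix_inv J *v (J *v y) = y" "J *v (matrix_inv J *v y) = y"
  by (simp_all add: matrix_vector_mul_assoc matrix_inv[OF inv])

lemma measurable_quad [measurable]: "quad \<in> borel_measurable borel"
  unfolding quad_def by measurable

lemma measurable_loglik [measurable]: "loglik t \<in> borel_measurable borel"
  unfolding loglik_def by measurable

lemma inv_inv: "matrix_inv (matrix_inv J) = J"
  by (rule matrix_inv_unique) (rule matrix_inv[OF inv])

text \<open>For \<open>det J \<le> 0\<close> the normalising constant of \<open>mv_normal 0 J\<close> degenerates and its mass is zero.\<close>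

lemma det_pos: "det J > 0"
proof (rule ccontr)
  assume "\<not> det J > 0"
  then have "(2 * pi) ^ CARD('n) * det J \<le> 0"
    by (simp add: mult_nonneg_nonpos)
  then have "sqrt ((2 * pi) ^ CARD('n) * det J) \<le> 0"
    by simp
  then have "mv_normal 0 J = density lborel (\<lambda>y. 0)"
    unfolding mv_normal_def by (intro density_cong) (auto simp: ennreal_neg divide_nonneg_nonpos)
  then have "emeasure (mv_normal 0 J) UNIV = 0"
    by (simp add: emeasure_density)
  moreover have "space (mv_normal 0 J) = UNIV"
    by (simp add: mv_normal_def)
  ultimately show False
    using prob_space.emeasure_space_1[OF prob] by simp
qed

text \<open>The second equation says that the Jacobian of \<open>s = J y\<close> converts the
  normalising constant for covariance \<open>J\<close> into the one for its inverse.\<close>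

lemma normalizer: "normalizer > 0" "det J / sqrt ((2 * pi) ^ CARD('n) * det J) = 1 / normalizer"
proof -
  have "det (matrix_inv J) * det J = 1"
    by (metis det_I det_mul inv matrix_inv(2))
  then have d: "det (matrix_inv J) = 1 / det J"
    using det_pos by (simp add: field_simps)
  then show "normalizer > 0"
    using det_pos by (simp add: normalizer_def)
  have "sqrt (det J) * sqrt (det J) = det J"
    using det_pos by simp
  then show "det J / sqrt ((2 * pi) ^ CARD('n) * det J) = 1 / normalizer"
    using det_pos by (simp add: normalizer_def d real_sqrt_mult real_sqrt_divide field_simps)
qed

lemma quad_add: "quad (y + z) = quad y + 2 * (z \<bullet> (J *v y)) + quad z"
  using symmetric_dot[OF sym, of y z] by (simp add: quad_def matrix_vector_right_distrib inner_add inner_commute)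

lemma quad_diff: "quad (y - z) = quad y - 2 * (z \<bullet> (J *v y)) + quad z"
  using symmetric_dot[OF sym, of y z]
  by (simp add: quad_def matrix_vector_mult_diff_distrib inner_diff inner_commute)

lemma gaussian_shift_density:
  "gaussian_shift J t = density lborel (\<lambda>y. ennreal (exp (- quad (y - t) / 2) / normalizer))"
proof (rule measure_eqI)
  fix B assume "B \<in> sets (gaussian_shift J t)"
  then have [measurable]: "B \<in> sets borel" by (simp add: gaussian_shift_def)
  have "emeasure (gaussian_shift J t) B
      = (\<integral>\<^sup>+v. ennreal (exp (- quad v / 2) / normalizer) * indicator B (t + v) \<partial>lborel)"
    unfolding gaussian_shift_def mv_normal_def inv_inv diff_zero quad_def[symmetric] normalizer_def[symmetric]
    by (subst nn_integral_indicator[symmetric], simp, subst nn_integral_distr)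
       (auto simp: nn_integral_density)
  also have "\<dots> = (\<integral>\<^sup>+v. ennreal (exp (- quad ((v + t) - t) / 2) / normalizer) * indicator B (v + t) \<partial>lborel)"
    by (simp add: add.commute)
  also have "\<dots> = (\<integral>\<^sup>+y. ennreal (exp (- quad (y - t) / 2) / normalizer) * indicator B y \<partial>lborel)"
    by (rule nn_integral_lborel_translate[where f="\<lambda>y. ennreal (exp (- quad (y - t) / 2) / normalizer) * indicator B y"])
       measurable
  also have "\<dots> = emeasure (density lborel (\<lambda>y. ennreal (exp (- quad (y - t) / 2) / normalizer))) B"
    by (simp add: emeasure_density)
  finally show "emeasure (gaussian_shift J t) B = \<dots>" .
qed (simp add: gaussian_shift_def)

lemma sets_gaussian_shift [simp, measurable_cong]: "sets (gaussian_shift J t) = sets borel"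
  by (simp add: gaussian_shift_def)

lemma space_gaussian_shift [simp]: "space (gaussian_shift J t) = UNIV"
  by (simp add: gaussian_shift_def)

lemma sets_mv_normal [simp, measurable_cong]: "sets (mv_normal 0 J) = sets borel"
  by (simp add: mv_normal_def)

text \<open>Completing the square after the substitution \<open>s = J y\<close>.\<close>

lemma gaussian_shift_eq_distr:
  "gaussian_shift J t =
     distr (density (mv_normal 0 J) (\<lambda>s. ennreal (exp (loglik t s)))) borel ((*v) (matrix_inv J))"
proof (rule measure_eqI)
  fix B assume "B \<in> sets (gaussian_shift J t)"
  then have [measurable]: "B \<in> sets borel" by (simp add: gaussian_shift_def)
  let ?Z = "sqrt ((2 * pi) ^ CARD('n) * det J)"
  let ?f = "\<lambda>s. ennreal (exp (- (s \<bullet> (matrix_inv J *v s)) / 2) / ?Z) *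
    (ennreal (exp (loglik t s)) * indicator B (matrix_inv J *v s))"
  have Z: "?Z > 0" using det_pos by simp
  have "emeasure (distr (density (mv_normal 0 J) (\<lambda>s. ennreal (exp (loglik t s)))) borel ((*v) (matrix_inv J))) B
      = (\<integral>\<^sup>+s. ?f s \<partial>lborel)"
    unfolding mv_normal_def diff_zero
    by (subst nn_integral_indicator[symmetric], simp, subst nn_integral_distr)
       (auto simp: nn_integral_density)
  also have "\<dots> = ennreal \<bar>det J\<bar> * (\<integral>\<^sup>+y. ?f (J *v y) \<partial>lborel)"
    using det_pos by (intro linear_change_of_variables) auto
  also have "\<dots> = (\<integral>\<^sup>+y. ennreal \<bar>det J\<bar> * ?f (J *v y) \<partial>lborel)"
    by (rule nn_integral_cmult[symmetric]) measurable
  also have "\<dots> = (\<integral>\<^sup>+y. ennreal (exp (- quad (y - t) / 2) / normalizer) * indicator B y \<partial>lborel)"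
  proof (rule nn_integral_cong)
    fix y
    have "- ((J *v y) \<bullet> y) / 2 + loglik t (J *v y) = - quad (y - t) / 2"
      unfolding quad_diff by (simp add: loglik_def quad_def inner_commute field_simps)
    then have "exp (- ((J *v y) \<bullet> y) / 2) * exp (loglik t (J *v y)) = exp (- quad (y - t) / 2)"
      by (simp flip: exp_add)
    then have "\<bar>det J\<bar> * (exp (- ((J *v y) \<bullet> y) / 2) / ?Z * exp (loglik t (J *v y)))
        = exp (- quad (y - t) / 2) * (det J / ?Z)"
      using det_pos by (simp add: field_simps)
    also have "\<dots> = exp (- quad (y - t) / 2) / normalizer"
      unfolding normalizer(2) by simp
    finally show "ennreal \<bar>det J\<bar> * ?f (J *v y) = ennreal (exp (- quad (y - t) / 2) / normalizer) * indicator B y"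
      using Z by (simp add: ennreal_mult'[symmetric] mult.assoc[symmetric])
  qed
  also have "\<dots> = emeasure (gaussian_shift J t) B"
    by (simp add: gaussian_shift_density emeasure_density)
  finally show "emeasure (gaussian_shift J t) B
    = emeasure (distr (density (mv_normal 0 J) (\<lambda>s. ennreal (exp (loglik t s)))) borel ((*v) (matrix_inv J))) B"
    by simp
qed simp

text \<open>At \<open>t = 0\<close> there is no tilt, so the law is an image of
  \<open>mv_normal 0 J\<close>; every other law is a translate of it.\<close>

lemma prob_space_gaussian_shift: "prob_space (gaussian_shift J t)"
proof -
  have "gaussian_shift J 0 = distr (mv_normal 0 J) borel ((*v) (matrix_inv J))"
    unfolding gaussian_shift_eq_distr by (simp add: loglik_def density_1)
  then have "prob_space (gaussian_shift J 0)"
    using prob by (simp add: prob_space.prob_space_distr)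
  moreover have "gaussian_shift J 0 = mv_normal 0 (matrix_inv J)"
    unfolding gaussian_shift_def add_0_left by (rule distr_id2) (simp add: mv_normal_def)
  ultimately show ?thesis
    unfolding gaussian_shift_def
    by (intro prob_space.prob_space_distr) (auto simp: mv_normal_def)
qed

text \<open>The tilted measure is carried onto a shift by \<open>matrix_inv J\<close>, and images
  preserve mass. This discharges the contiguity assumption \<open>mass\<close>.\<close>

lemma mass_loglik: "(\<integral>\<^sup>+s. ennreal (exp (loglik t s)) \<partial>mv_normal 0 J) = 1"
proof -
  have "(\<integral>\<^sup>+s. ennreal (exp (loglik t s)) \<partial>mv_normal 0 J)
      = emeasure (density (mv_normal 0 J) (\<lambda>s. ennreal (exp (loglik t s)))) UNIV"
    by (subst emeasure_density) auto
  also have "\<dots> = emeasure (gaussian_shift J t) UNIV"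
    unfolding gaussian_shift_eq_distr by (subst emeasure_distr) (auto simp: mv_normal_def)
  also have "\<dots> = 1"
    using prob_space.emeasure_space_1[OF prob_space_gaussian_shift] by simp
  finally show ?thesis .
qed

lemma integral_gaussian_shift:
  fixes f :: "real^'n \<Rightarrow> real"
  assumes [measurable]: "f \<in> borel_measurable borel"
  shows "(\<integral>y. f y \<partial>gaussian_shift J t) = (\<integral>s. f (matrix_inv J *v s) * exp (loglik t s) \<partial>mv_normal 0 J)"
  unfolding gaussian_shift_eq_distr
  by (subst integral_distr) (auto simp: integral_density mult.commute)

text \<open>The quadratic terms in \<open>y\<close> cancel in the quotient of two shifts. What
  remains is the limiting log-ratio of the third lemma evaluated at \<open>s = J y\<close>.\<close>

lemma gaussian_shift_density_shift:
  "gaussian_shift J h = density (gaussian_shift J h0)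
     (\<lambda>y. ennreal (exp (loglik h (J *v y) - loglik h0 (J *v y))))"
proof -
  have "density (gaussian_shift J h0) (\<lambda>y. ennreal (exp (loglik h (J *v y) - loglik h0 (J *v y))))
    = density lborel (\<lambda>y. ennreal (exp (- quad (y - h0) / 2) / normalizer) *
        ennreal (exp (loglik h (J *v y) - loglik h0 (J *v y))))"
    unfolding gaussian_shift_density by (subst density_density_eq) auto
  also have "\<dots> = gaussian_shift J h"
    unfolding gaussian_shift_density
  proof (intro density_cong AE_I2)
    fix y
    have "- quad (y - h0) / 2 + (loglik h (J *v y) - loglik h0 (J *v y)) = - quad (y - h) / 2"
      unfolding quad_diff by (simp add: loglik_def quad_def field_simps)
    then have "exp (- quad (y - h0) / 2) * exp (loglik h (J *v y) - loglik h0 (J *v y)) = exp (- quad (y - h) / 2)"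
      by (simp flip: exp_add)
    then show "ennreal (exp (- quad (y - h0) / 2) / normalizer) * ennreal (exp (loglik h (J *v y) - loglik h0 (J *v y)))
      = ennreal (exp (- quad (y - h) / 2) / normalizer)"
      using normalizer(1) by (simp add: ennreal_mult'[symmetric])
  qed auto
  finally show ?thesis by simp
qed

lemma likelihood_ratio_gaussian_shift:
  "AE y in gaussian_shift J h0. likelihood_ratio (gaussian_shift J h0) (gaussian_shift J h) y
     = exp (loglik h (J *v y) - loglik h0 (J *v y))"
proof (rule is_likelihood_ratio_unique)
  show "is_likelihood_ratio (gaussian_shift J h0) (gaussian_shift J h)
      (likelihood_ratio (gaussian_shift J h0) (gaussian_shift J h))"
    by (intro likelihood_ratio prob_space.finite_measure prob_space_gaussian_shift) simp
  show "is_likelihood_ratio (gaussian_shift J h0) (gaussian_shift J h)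
      (\<lambda>y. exp (loglik h (J *v y) - loglik h0 (J *v y)))"
    by (subst gaussian_shift_density_shift[of h h0]) (intro is_likelihood_ratio_density, auto)
qed (auto intro: prob_space.finite_measure prob_space_gaussian_shift)

text \<open>
  Shifting along \<open>w\<close> multiplies the density by a function of the \<open>i\<close>-th coordinate alone, so the law
  of this coordinate, multiplied by the reciprocal normal density, is translation invariant.
\<close>

lemma marginal_std_normal:
  assumes w: "J *v w = \<kappa> *\<^sub>R axis i 1" "w $ i = 1" and \<kappa>: "\<kappa> > 0"
  shows "distr (gaussian_shift J t) borel (\<lambda>y. sqrt \<kappa> * (y $ i - t $ i)) = std_normal_distribution"
proof -
  define Q where "Q = gaussian_shift J 0"
  define \<nu> where "\<nu> = distr Q borel (\<lambda>y. sqrt \<kappa> * y $ i)"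
  have [measurable_cong]: "sets Q = sets borel" "sets \<nu> = sets borel"
    by (simp_all add: Q_def \<nu>_def)
  interpret \<nu>: prob_space \<nu>
    unfolding \<nu>_def by (rule prob_space.prob_space_distr) (auto simp: Q_def prob_space_gaussian_shift)
  \<comment> \<open>Dividing out the Gaussian factor should leave a multiple of Lebesgue
    measure.\<close>
  define M where "M = density \<nu> (\<lambda>x. ennreal (exp (x\<^sup>2 / 2)))"
  have [measurable_cong]: "sets M = sets borel"
    by (simp add: M_def \<nu>_def)
  have nu: "(\<integral>\<^sup>+x. f x \<partial>\<nu>) = (\<integral>\<^sup>+y. ennreal (exp (- quad y / 2) / normalizer) * f (sqrt \<kappa> * y $ i) \<partial>lborel)"
    if [measurable]: "f \<in> borel_measurable borel" for f :: "real \<Rightarrow> ennreal"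
    unfolding \<nu>_def Q_def
    by (subst nn_integral_distr) (auto simp: gaussian_shift_density nn_integral_density)
  have M: "(\<integral>\<^sup>+x. f x \<partial>M) = (\<integral>\<^sup>+x. ennreal (exp (x\<^sup>2 / 2)) * f x \<partial>\<nu>)"
    if [measurable]: "f \<in> borel_measurable borel" for f :: "real \<Rightarrow> ennreal"
    unfolding M_def by (simp add: nn_integral_density)
  have "sigma_finite_measure M"
    unfolding M_def by (subst \<nu>.sigma_finite_iff_density_finite) auto
  then obtain c where c: "\<And>f. f \<in> borel_measurable borel \<Longrightarrow> (\<integral>\<^sup>+x. f x \<partial>M) = c * (\<integral>\<^sup>+x. f x \<partial>lborel)"
  proof (rule translation_invariant_eq_lborel)
    fix a :: real and f :: "real \<Rightarrow> ennreal" assume [measurable]: "f \<in> borel_measurable borel"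
    \<comment> \<open>Since \<open>w $ i = 1\<close>, moving by \<open>b\<close> along
      \<open>w\<close> moves the rescaled coordinate by \<open>a\<close>. As
      \<open>quad w = \<kappa>\<close>, the changes of the two exponents cancel.\<close>
    define b where "b = a / sqrt \<kappa>"
    let ?F = "\<lambda>y. ennreal (exp (- quad y / 2) / normalizer) * (ennreal (exp ((sqrt \<kappa> * y $ i)\<^sup>2 / 2)) * f (sqrt \<kappa> * y $ i))"
    have "(\<integral>\<^sup>+x. f (x + a) \<partial>M) = (\<integral>\<^sup>+y. ennreal (exp (- quad y / 2) / normalizer) *
        (ennreal (exp ((sqrt \<kappa> * y $ i)\<^sup>2 / 2)) * f (sqrt \<kappa> * y $ i + a)) \<partial>lborel)"
      by (simp add: M nu)
    also have "\<dots> = (\<integral>\<^sup>+y. ?F (y + b *\<^sub>R w) \<partial>lborel)"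
    proof (rule nn_integral_cong)
      fix y
      have coord: "sqrt \<kappa> * (y + b *\<^sub>R w) $ i = sqrt \<kappa> * y $ i + a"
        using \<kappa> w(2) by (simp add: b_def field_simps)
      have "w \<bullet> (J *v y) = \<kappa> * y $ i"
        using symmetric_dot[OF sym, of w y] w(1) by (simp add: inner_axis inner_commute)
      moreover have "quad w = \<kappa>"
        using w by (simp add: quad_def inner_axis)
      moreover have "quad (b *\<^sub>R w) = b\<^sup>2 * quad w"
        by (simp add: quad_def matrix_vector_mult_scaleR power2_eq_square)
      ultimately have "quad (y + b *\<^sub>R w) = quad y + 2 * b * (\<kappa> * y $ i) + b\<^sup>2 * \<kappa>"
        unfolding quad_add by simp
      moreover have "(sqrt \<kappa> * y $ i + a)\<^sup>2 = (sqrt \<kappa> * y $ i)\<^sup>2 + 2 * b * (\<kappa> * y $ i) + b\<^sup>2 * \<kappa>"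
      proof -
        have "a = sqrt \<kappa> * b" using \<kappa> by (simp add: b_def)
        moreover have "sqrt \<kappa> * sqrt \<kappa> = \<kappa>" using \<kappa> by simp
        ultimately show ?thesis by (simp add: power2_eq_square algebra_simps)
      qed
      ultimately have "- quad (y + b *\<^sub>R w) / 2 + (sqrt \<kappa> * y $ i + a)\<^sup>2 / 2 = - quad y / 2 + (sqrt \<kappa> * y $ i)\<^sup>2 / 2"
        by (simp add: field_simps)
      then have "exp (- quad (y + b *\<^sub>R w) / 2) * exp ((sqrt \<kappa> * y $ i + a)\<^sup>2 / 2)
          = exp (- quad y / 2) * exp ((sqrt \<kappa> * y $ i)\<^sup>2 / 2)"
        by (simp only: exp_add[symmetric])
      then show "ennreal (exp (- quad y / 2) / normalizer) *
        (ennreal (exp ((sqrt \<kappa> * y $ i)\<^sup>2 / 2)) * f (sqrt \<kappa> * y $ i + a)) = ?F (y + b *\<^sub>R w)"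
        unfolding coord using normalizer(1)
        by (simp add: ennreal_mult'[symmetric] mult.assoc[symmetric])
    qed
    also have "\<dots> = (\<integral>\<^sup>+y. ?F y \<partial>lborel)"
      by (rule nn_integral_lborel_translate) measurable
    also have "\<dots> = (\<integral>\<^sup>+x. f x \<partial>M)"
      by (simp add: M nu)
    finally show "(\<integral>\<^sup>+x. f (x + a) \<partial>M) = (\<integral>\<^sup>+x. f x \<partial>M)" .
  qed (simp_all add: M_def \<nu>_def)
  \<comment> \<open>The factor absorbs the constant of the standard normal density; both laws have
    mass one, hence \<open>c' = 1\<close>.\<close>
  define c' where "c' = c * ennreal (sqrt (2 * pi))"
  have nu_c: "(\<integral>\<^sup>+x. f x \<partial>\<nu>) = c' * (\<integral>\<^sup>+x. ennreal (std_normal_density x) * f x \<partial>lborel)"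
    if [measurable]: "f \<in> borel_measurable borel" for f :: "real \<Rightarrow> ennreal"
  proof -
    have "(\<integral>\<^sup>+x. f x \<partial>\<nu>) = (\<integral>\<^sup>+x. ennreal (exp (- x\<^sup>2 / 2)) * f x \<partial>M)"
      by (simp add: M mult.assoc[symmetric] ennreal_mult'[symmetric] flip: exp_add)
    also have "\<dots> = c * (\<integral>\<^sup>+x. ennreal (sqrt (2 * pi)) * (ennreal (std_normal_density x) * f x) \<partial>lborel)"
      by (subst c) (auto simp: std_normal_density_def mult.assoc[symmetric] ennreal_mult'[symmetric])
    finally show ?thesis
      by (simp add: nn_integral_cmult c'_def mult.assoc)
  qed
  have "(\<integral>\<^sup>+x. ennreal (std_normal_density x) \<partial>lborel) = 1"
  proof -
    interpret std: prob_space std_normal_distribution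
      by (rule prob_space_normal_density) simp
    show ?thesis
      using std.emeasure_space_1 by (simp add: emeasure_density)
  qed
  then have c': "c' = 1"
    using nu_c[of "\<lambda>_. 1"] \<nu>.emeasure_space_1 by simp
  have "\<nu> = std_normal_distribution"
  proof (rule measure_eqI)
    fix B assume "B \<in> sets \<nu>"
    then have [measurable]: "B \<in> sets borel" by (simp add: \<nu>_def)
    show "emeasure \<nu> B = emeasure std_normal_distribution B"
      using nu_c[of "indicator B"] by (simp add: c' emeasure_density)
  qed (simp add: \<nu>_def)
  moreover have "distr (gaussian_shift J t) borel (\<lambda>y. sqrt \<kappa> * (y $ i - t $ i)) = \<nu>"
    unfolding \<nu>_def Q_def gaussian_shift_def
    by (subst (1 2) distr_distr) (auto simp: mv_normal_def comp_def)
  ultimately show ?thesis by simp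
qed

end

section \<open>The standard normal quantile\<close>

lemma isCont_cdf_std_normal: "isCont (cdf std_normal_distribution) x"
proof -
  interpret real_distribution std_normal_distribution by (rule real_dist_normal_dist)
  have "emeasure std_normal_distribution {x} = 0"
    by (simp add: emeasure_density nn_integral_null_set)
  then show ?thesis
    by (simp add: isCont_cdf measure_def)
qed

text \<open>\<open>inv\<close> chooses some preimage, so it suffices that \<open>u\<close> is
  attained, which the intermediate value theorem gives.\<close>

lemma cdf_normal_quantile:
  assumes "0 < u" "u < 1"
  shows "cdf std_normal_distribution (normal_quantile u) = u"
proof -
  interpret real_distribution std_normal_distribution by (rule real_dist_normal_dist)
  let ?F = "cdf std_normal_distribution"
  obtain a where a: "?F a < u"
    using order_tendstoD(2)[OF cdf_lim_at_bot assms(1)] by (auto simp: eventually_at_bot_linorder)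
  obtain b where b: "?F b > u"
    using order_tendstoD(1)[OF cdf_lim_at_top_prob assms(2)] by (auto simp: eventually_at_top_linorder)
  have "a \<le> b"
    using a b cdf_nondecreasing[of b a] by linarith
  then obtain x where "?F x = u"
    using IVT[of ?F a u b] a b isCont_cdf_std_normal by auto
  then have "u \<in> range ?F" by auto
  then show ?thesis
    unfolding normal_quantile_def by (rule f_inv_into_f)
qed

section \<open>Optimality of the half-space test\<close>

context gaussian_shift_experiment
begin

text \<open>The centred tested coordinate has the same law under every shift, so the size is exactly
  \<open>\<alpha>\<close> at every null point. The test does not depend on the alternative, so being
  most powerful against each one makes it uniformly most powerful.\<close>

lemma ump_half_space_test:
  assumes w: "J *v w = \<kappa> *\<^sub>R axis i 1" "w $ i = 1" and \<kappa>: "\<kappa> > 0"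
    and \<alpha>: "0 < \<alpha>" "\<alpha> < 1"
  shows "ump_test (gaussian_shift J) {t. t $ i = 0} {t. 0 < t $ i} \<alpha>
    (indicator {y. y $ i \<ge> normal_quantile (1 - \<alpha>) * \<kappa> powr (-1/2)})"
proof -
  define z where "z = normal_quantile (1 - \<alpha>)"
  define b where "b = z * \<kappa> powr (-1/2)"
  have "\<kappa> powr (-1/2) = inverse (sqrt \<kappa>)"
    using \<kappa> powr_minus[of \<kappa> "1/2"] by (simp add: powr_half_sqrt)
  then have b: "b = z / sqrt \<kappa>"
    unfolding b_def by (simp only: divide_inverse)
  define \<phi> where "\<phi> = (indicator {y. y $ i \<ge> b} :: real^'n \<Rightarrow> real)"
  have half_space [measurable]: "{y :: real^'n. b \<le> y $ i} \<in> sets borel"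
    by measurable
  have \<phi>_meas [measurable]: "\<phi> \<in> borel_measurable borel"
    by (simp add: \<phi>_def)
  have bounded_int: "integrable (gaussian_shift J t) f"
    if "f \<in> borel_measurable (gaussian_shift J t)" "\<forall>y. 0 \<le> f y \<and> f y \<le> 1" for f :: "real^'n \<Rightarrow> real" and t
  proof -
    interpret prob_space "gaussian_shift J t" by (rule prob_space_gaussian_shift)
    show ?thesis
      using that by (intro integrable_const_bound[where B=1]) auto
  qed
  have size: "(\<integral>y. \<phi> y \<partial>gaussian_shift J t) = \<alpha>" if "t $ i = 0" for t
  proof -
    interpret std: real_distribution std_normal_distribution by (rule real_dist_normal_dist)
    have "(\<integral>y. \<phi> y \<partial>gaussian_shift J t) = (\<integral>y. indicator {z..} (sqrt \<kappa> * (y $ i - t $ i)) \<partial>gaussian_shift J t)"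
      using \<kappa> that by (intro Bochner_Integration.integral_cong)
        (auto simp: \<phi>_def b indicator_def field_simps)
    also have "\<dots> = (\<integral>x. indicator {z..} x \<partial>distr (gaussian_shift J t) borel (\<lambda>y. sqrt \<kappa> * (y $ i - t $ i)))"
      by (subst integral_distr) auto
    also have "\<dots> = measure std_normal_distribution {z..}"
      unfolding marginal_std_normal[OF w \<kappa>] by simp
    \<comment> \<open>\<open>cdf\<close> measures the closed left ray, whose complement is the open
      right ray; the boundary point is no atom.\<close>
    also have "\<dots> = measure std_normal_distribution {z<..}"
    proof -
      have "measure std_normal_distribution {z} = 0"
        using isCont_cdf_std_normal[of z] by (simp add: std.isCont_cdf)
      moreover have "{z..} = {z} \<union> {z<..}" by auto
      ultimately show ?thesis
        by (subst \<open>{z..} = _\<close>, subst std.finite_measure_Union) auto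
    qed
    also have "\<dots> = 1 - cdf std_normal_distribution z"
    proof -
      have "{z<..} = space std_normal_distribution - {..z}" by auto
      then show ?thesis
        by (subst \<open>{z<..} = _\<close>, subst std.prob_compl) (auto simp: cdf_def)
    qed
    also have "\<dots> = \<alpha>"
      using cdf_normal_quantile[of "1 - \<alpha>"] \<alpha> by (simp add: z_def)
    finally show ?thesis .
  qed
  have \<phi>_range: "\<forall>y. 0 \<le> \<phi> y \<and> \<phi> y \<le> 1"
    by (auto simp: \<phi>_def indicator_def)
  have level: "level_test (gaussian_shift J) {t. t $ i = 0} {t. 0 < t $ i} \<alpha> \<phi>"
    unfolding level_test_def using \<phi>_range by (auto simp: size)
  have power: "(\<integral>y. \<psi> y \<partial>gaussian_shift J h) \<le> (\<integral>y. \<phi> y \<partial>gaussian_shift J h)"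
    if \<psi>: "level_test (gaussian_shift J) {t. t $ i = 0} {t. 0 < t $ i} \<alpha> \<psi>" and h: "0 < h $ i" for \<psi> h
  proof -
    txt \<open>Neyman--Pearson against the least favourable null point on the line through \<open>h\<close> in
      direction \<open>w\<close>: there the likelihood ratio is an increasing function of the \<open>i\<close>-th coordinate.\<close>
    define a where "a = h $ i"
    define h0 where "h0 = h - a *\<^sub>R w"
    define Q where "Q = gaussian_shift J h0"
    have h0: "h0 $ i = 0" using w(2) by (simp add: h0_def a_def)
    interpret Q: prob_space Q unfolding Q_def by (rule prob_space_gaussian_shift)
    have sets_Q [measurable_cong]: "sets Q = sets borel" by (simp add: Q_def)
    define L where "L y = exp (loglik h (J *v y) - loglik h0 (J *v y))" for y
    have [measurable]: "L \<in> borel_measurable borel" unfolding L_def by measurable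
    define c where "c = (h \<bullet> (J *v h) - h0 \<bullet> (J *v h0)) / 2"
    have "w \<bullet> (J *v y) = \<kappa> * y $ i" for y
      using symmetric_dot[OF sym, of w y] w(1) by (simp add: inner_axis inner_commute)
    then have L: "L y = exp (a * \<kappa> * y $ i - c)" for y
      unfolding L_def loglik_def c_def by (simp add: h0_def inner_diff_left field_simps)
    \<comment> \<open>The likelihood ratio at the boundary \<open>y $ i = b\<close>. Since
      \<open>a * \<kappa>\<close> is positive, \<open>\<phi>\<close> rejects exactly where
      \<open>L\<close> is at least \<open>k\<close>, so the two factors below never have opposite
      signs.\<close>
    define k where "k = exp (a * \<kappa> * b - c)"
    have mono: "(\<phi> y - \<psi> y) * (L y - k) \<ge> 0" for y
    proof (cases "y $ i \<ge> b")
      case True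
      then have "a * \<kappa> * b \<le> a * \<kappa> * y $ i"
        using h \<kappa> by (intro mult_left_mono) (auto simp: a_def)
      then have "L y \<ge> k" by (simp add: L k_def)
      moreover have "\<phi> y \<ge> \<psi> y" using True \<psi> by (auto simp: \<phi>_def level_test_def)
      ultimately show ?thesis by simp
    next
      case False
      then have "a * \<kappa> * y $ i \<le> a * \<kappa> * b"
        using h \<kappa> by (intro mult_left_mono) (auto simp: a_def)
      then have "L y \<le> k" by (simp add: L k_def)
      moreover have "\<phi> y \<le> \<psi> y" using False \<psi> by (auto simp: \<phi>_def level_test_def)
      ultimately show ?thesis by (simp add: mult_nonpos_nonpos)
    qed
    have [measurable]: "\<psi> \<in> borel_measurable borel"
    proof -
      have "\<psi> \<in> borel_measurable (gaussian_shift J h)"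
        using \<psi> h unfolding level_test_def by auto
      then show ?thesis by (simp cong: measurable_cong_sets)
    qed
    have \<psi>_range: "\<forall>y. 0 \<le> \<psi> y \<and> \<psi> y \<le> 1"
      using \<psi> by (auto simp: level_test_def)
    have Qh: "gaussian_shift J h = density Q (\<lambda>y. ennreal (L y))"
      unfolding Q_def L_def by (rule gaussian_shift_density_shift)
    have L_nonneg: "0 \<le> L y" for y by (simp add: L_def)
    have int_h: "(\<integral>y. f y \<partial>gaussian_shift J h) = (\<integral>y. L y * f y \<partial>Q)" "integrable Q (\<lambda>y. L y * f y)"
      if [measurable]: "f \<in> borel_measurable borel" and "\<forall>y. 0 \<le> f y \<and> f y \<le> 1" for f
      using bounded_int[of f h] that(2) L_nonneg unfolding Qh
      by (auto simp: integral_density integrable_density)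
    have int_Q: "integrable Q \<phi>" "integrable Q \<psi>"
      unfolding Q_def using \<phi>_range \<psi>_range by (auto intro!: bounded_int)
    have "0 \<le> (\<integral>y. (\<phi> y - \<psi> y) * (L y - k) \<partial>Q)"
      using mono by (intro integral_nonneg_AE) auto
    also have "\<dots> = (\<integral>y. (L y * \<phi> y - L y * \<psi> y) - k * (\<phi> y - \<psi> y) \<partial>Q)"
      by (intro Bochner_Integration.integral_cong) (auto simp: algebra_simps)
    also have "\<dots> = ((\<integral>y. \<phi> y \<partial>gaussian_shift J h) - (\<integral>y. \<psi> y \<partial>gaussian_shift J h))
        - k * ((\<integral>y. \<phi> y \<partial>Q) - (\<integral>y. \<psi> y \<partial>Q))"
      using int_h(1)[OF \<phi>_meas \<phi>_range] int_h(1)[of \<psi>] int_h(2)[OF \<phi>_meas \<phi>_range] int_h(2)[of \<psi>] \<psi>_range int_Q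
      by simp
    finally have "k * ((\<integral>y. \<phi> y \<partial>Q) - (\<integral>y. \<psi> y \<partial>Q))
        \<le> (\<integral>y. \<phi> y \<partial>gaussian_shift J h) - (\<integral>y. \<psi> y \<partial>gaussian_shift J h)"
      by simp
    \<comment> \<open>Here exactness of the size matters: any level test has at most the size of
      \<open>\<phi>\<close> at \<open>h0\<close>.\<close>
    moreover have "(\<integral>y. \<psi> y \<partial>Q) \<le> (\<integral>y. \<phi> y \<partial>Q)"
      using \<psi> h0 size[OF h0] unfolding level_test_def Q_def by auto
    then have "0 \<le> k * ((\<integral>y. \<phi> y \<partial>Q) - (\<integral>y. \<psi> y \<partial>Q))"
      by (simp add: k_def)
    ultimately show ?thesis by linarith
  qed
  show ?thesis
    using level power unfolding ump_test_def \<phi>_def b_def z_def by auto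
qed

end

section \<open>Block algebra and the efficient score\<close>

lemma sum_option: "(\<Sum>k\<in>UNIV. f k) = f None + (\<Sum>i\<in>UNIV. f (Some i))"
  for f :: "'p::finite option \<Rightarrow> 'b::comm_monoid_add"
  by (simp add: UNIV_option_conv sum.reindex)

lemma block_vec_nth [simp]: "block_vec a b $ None = a" "block_vec a b $ Some i = b $ i"
  by (simp_all add: block_vec_def)

lemma inner_block_vec: "block_vec a b \<bullet> s = a * s $ None + b \<bullet> nuisance_part s"
  by (simp add: inner_vec_def sum_option nuisance_part_def)

lemma mult_block_vec:
  "(J *v block_vec a b) $ None = a * xi_xi J + xi_theta J \<bullet> b"
  "nuisance_part (J *v block_vec a b) = a *\<^sub>R theta_xi J + theta_theta J *v b"
  by (simp_all add: matrix_vector_mult_def sum_option xi_xi_def xi_theta_def theta_xi_def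
      theta_theta_def nuisance_part_def inner_vec_def vec_eq_iff)

text \<open>
  The direction obtained from the unit vector of the tested parameter by projecting out the
  nuisance scores; it spans the least favourable submodel.
\<close>

definition efficient_direction :: "real^('p::finite option)^('p option) \<Rightarrow> real^('p option)" where
  "efficient_direction J = block_vec 1 (- (matrix_inv (theta_theta J) *v theta_xi J))"

context
  fixes J :: "real^('p::finite option)^('p option)"
  assumes sym: "transpose J = J" and pd: "\<And>y. y \<noteq> 0 \<Longrightarrow> 0 < y \<bullet> (J *v y)"
begin

text \<open>A kernel vector of the block, padded with zero, would annihilate the quadratic form of
  \<open>J\<close>.\<close>

lemma invertible_theta_theta: "invertible (theta_theta J)"
proof -
  have "x = 0" if x: "theta_theta J *v x = 0" for x
  proof -
    have "block_vec 0 x \<bullet> (J *v block_vec 0 x) = 0"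
      by (simp add: inner_block_vec mult_block_vec x)
    then have "block_vec 0 x = 0"
      using pd[of "block_vec 0 x"] by fastforce
    then show ?thesis
      by (metis (no_types) block_vec_nth(2) vec_eq_iff zero_index)
  qed
  then show ?thesis
    by (simp add: invertible_left_inverse matrix_left_invertible_ker)
qed

text \<open>The nuisance entries of the direction solve the equations that make the nuisance entries
  of the product vanish; the entry left over is the Schur complement.\<close>

lemma mult_efficient_direction:
  "J *v efficient_direction J = efficient_info J *\<^sub>R axis None 1"
proof -
  let ?b = "- (matrix_inv (theta_theta J) *v theta_xi J)"
  have "theta_theta J *v ?b = - theta_xi J"
    by (simp add: linear_neg[OF matrix_vector_mul_linear] matrix_vector_mul_assoc matrix_inv[OF invertible_theta_theta])
  then have "nuisance_part (J *v block_vec 1 ?b) = 0"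
    by (simp add: mult_block_vec)
  then have Some: "(J *v block_vec 1 ?b) $ Some i = 0" for i
    by (simp add: nuisance_part_def vec_eq_iff)
  have None: "(J *v block_vec 1 ?b) $ None = efficient_info J"
    by (simp add: mult_block_vec efficient_info_def)
  have "(J *v block_vec 1 ?b) $ k = (efficient_info J *\<^sub>R axis None 1) $ k" for k
    by (cases k) (simp_all add: Some None axis_def)
  then show ?thesis
    by (simp add: vec_eq_iff efficient_direction_def)
qed

lemma efficient_info_pos: "efficient_info J > 0"
proof -
  have "efficient_direction J $ None = 1"
    by (simp add: efficient_direction_def)
  then have "efficient_direction J \<noteq> 0" by auto
  from pd[OF this] show ?thesis
    by (simp add: mult_efficient_direction inner_axis \<open>efficient_direction J $ None = 1\<close>)
qed

text \<open>The efficient score is the pairing of \<open>s\<close> with the efficient direction.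
  Writing \<open>s = J y\<close> and moving \<open>J\<close> across by symmetry leaves a multiple of
  \<open>y $ None\<close>, which identifies the statistic with its counterpart in the limit
  experiment.\<close>

lemma efficient_score_stat_eq:
  assumes inv: "invertible J"
  shows "efficient_score_stat J (s $ None) (nuisance_part s)
    = efficient_info J powr (1/2) * (matrix_inv J *v s) $ None"
proof -
  have sym': "transpose (theta_theta J) = theta_theta J" "xi_theta J = theta_xi J"
    using sym by (auto simp: vec_eq_iff transpose_def theta_theta_def xi_theta_def theta_xi_def)
  have "transpose (matrix_inv (theta_theta J)) = matrix_inv (theta_theta J)"
  proof (rule matrix_inv_unique[symmetric])
    show "theta_theta J ** transpose (matrix_inv (theta_theta J)) = mat 1"
      by (metis invertible_theta_theta matrix_inv(2) matrix_transpose_mul sym'(1) transpose_mat)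
  qed
  from symmetric_dot[OF this]
  have "xi_theta J \<bullet> (matrix_inv (theta_theta J) *v b) = (matrix_inv (theta_theta J) *v theta_xi J) \<bullet> b" for b
    by (simp add: sym'(2))
  then have "efficient_score_stat J (s $ None) (nuisance_part s)
      = efficient_info J powr (-1/2) * (efficient_direction J \<bullet> s)"
    by (simp add: efficient_score_stat_def efficient_direction_def inner_block_vec)
  also have "efficient_direction J \<bullet> s = efficient_direction J \<bullet> (J *v (matrix_inv J *v s))"
    by (simp add: matrix_vector_mul_assoc matrix_inv[OF inv])
  also have "\<dots> = efficient_info J * (matrix_inv J *v s) $ None"
    by (simp add: symmetric_dot[OF sym] mult_efficient_direction inner_axis')
  also have "efficient_info J powr (-1/2) * \<dots> = efficient_info J powr (1/2) * (matrix_inv J *v s) $ None"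
    using powr_add[of "efficient_info J" "-1/2" 1] efficient_info_pos by simp
  finally show ?thesis .
qed

end

section \<open>The information matrix as a positive definite Gram matrix\<close>

lemma borel_measurable_vecI:
  fixes f :: "'a \<Rightarrow> real^'n"
  assumes "\<And>k. (\<lambda>x. f x $ k) \<in> borel_measurable M"
  shows "f \<in> borel_measurable M"
  using assms by (subst borel_measurable_euclidean_space) (auto simp: Basis_vec_def inner_axis)

lemma borel_measurable_nth_compose [measurable (raw)]:
  fixes f :: "'a \<Rightarrow> real^'n"
  assumes "f \<in> borel_measurable M"
  shows "(\<lambda>x. f x $ k) \<in> borel_measurable M"
  using assms by (rule measurable_compose) (intro borel_measurable_continuous_onI continuous_intros)

lemma borel_measurable_block_vec:
  assumes [measurable]: "f \<in> borel_measurable M" "g \<in> borel_measurable M"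
  shows "(\<lambda>x. block_vec (f x) (g x)) \<in> borel_measurable M"
proof (rule borel_measurable_vecI)
  show "(\<lambda>x. block_vec (f x) (g x) $ k) \<in> borel_measurable M" for k
    by (cases k) simp_all
qed

lemma borel_measurable_v:
  assumes [measurable]: "p0 \<in> borel_measurable \<mu>" "d2 \<in> borel_measurable \<mu>" "g \<in> borel_measurable \<mu>"
  shows "v_xi p0 d2 \<in> borel_measurable \<mu>" "v_theta p0 g \<in> borel_measurable \<mu>"
proof -
  have ind: "indicator {x. p0 x > 0} x = (if p0 x > 0 then 1 else 0 :: real)" for x
    by (simp add: indicator_def)
  show "v_xi p0 d2 \<in> borel_measurable \<mu>"
    unfolding v_xi_def[abs_def] ind by measurable
  show "v_theta p0 g \<in> borel_measurable \<mu>"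
    unfolding v_theta_def[abs_def] ind by measurable
qed

lemma info_matrix_bilinear:
  assumes meas: "v_xi p0 d2 \<in> borel_measurable \<mu>" "v_theta p0 g \<in> borel_measurable \<mu>"
    and int: "integrable \<mu> (\<lambda>x. (v_xi p0 d2 x)\<^sup>2)" "\<And>i. integrable \<mu> (\<lambda>x. (v_theta p0 g x $ i)\<^sup>2)"
  defines "V \<equiv> \<lambda>x. block_vec (v_xi p0 d2 x) (v_theta p0 g x)"
  shows "y \<bullet> (info_matrix \<mu> p0 d2 g *v z) = 4 * (\<integral>x. (y \<bullet> V x) * (z \<bullet> V x) \<partial>\<mu>)"
proof -
  have [measurable]: "V \<in> borel_measurable \<mu>"
    unfolding V_def using meas by (rule borel_measurable_block_vec)
  have square: "integrable \<mu> (\<lambda>x. (V x $ k)\<^sup>2)" for k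
    using int by (cases k) (simp_all add: V_def)
  have prod: "integrable \<mu> (\<lambda>x. V x $ k * V x $ l)" for k l
  proof (rule Bochner_Integration.integrable_bound)
    show "integrable \<mu> (\<lambda>x. (V x $ k)\<^sup>2 + (V x $ l)\<^sup>2)"
      using square by simp
    have "\<bar>a * b\<bar> \<le> a\<^sup>2 + b\<^sup>2" for a b :: real
    proof -
      have "2 * (\<bar>a\<bar> * \<bar>b\<bar>) \<le> a\<^sup>2 + b\<^sup>2"
        using sum_squares_bound[of "\<bar>a\<bar>" "\<bar>b\<bar>"] by simp
      moreover have "0 \<le> \<bar>a\<bar> * \<bar>b\<bar>" by simp
      ultimately show ?thesis unfolding abs_mult by linarith
    qed
    then show "AE x in \<mu>. norm (V x $ k * V x $ l) \<le> norm ((V x $ k)\<^sup>2 + (V x $ l)\<^sup>2)"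
      by simp
  qed measurable
  have "(\<integral>x. (y \<bullet> V x) * (z \<bullet> V x) \<partial>\<mu>) = (\<integral>x. (\<Sum>k\<in>UNIV. \<Sum>l\<in>UNIV. y $ k * z $ l * (V x $ k * V x $ l)) \<partial>\<mu>)"
    by (simp add: inner_vec_def sum_product ac_simps)
  also have "\<dots> = (\<Sum>k\<in>UNIV. \<Sum>l\<in>UNIV. y $ k * z $ l * (\<integral>x. V x $ k * V x $ l \<partial>\<mu>))"
    using prod by simp
  finally show ?thesis
    by (simp add: inner_vec_def matrix_vector_mult_def info_matrix_def V_def sum_distrib_left ac_simps)
qed

text \<open>A zero of a nonnegative quadratic form is a minimum, so moving from \<open>y\<close>
  against \<open>v = J *v y\<close> cannot decrease the form. This forces \<open>J *v y = 0\<close>,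
  contradicting invertibility.\<close>

lemma positive_definite_if_invertible:
  fixes J :: "real^'n^'n"
  assumes sym: "transpose J = J" and inv: "invertible J"
    and psd: "\<And>y. 0 \<le> y \<bullet> (J *v y)" and y: "y \<noteq> 0"
  shows "0 < y \<bullet> (J *v y)"
proof (rule ccontr)
  assume "\<not> 0 < y \<bullet> (J *v y)"
  then have 0: "y \<bullet> (J *v y) = 0"
    using psd[of y] by simp
  define v where "v = J *v y"
  define q where "q = v \<bullet> (J *v v)"
  have "0 \<le> (y - c *\<^sub>R v) \<bullet> (J *v (y - c *\<^sub>R v))" for c
    by (rule psd)
  moreover have "(y - c *\<^sub>R v) \<bullet> (J *v (y - c *\<^sub>R v)) = c\<^sup>2 * q - 2 * c * (v \<bullet> v)" for c
    using symmetric_dot[OF sym, of y v] 0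
    by (simp add: matrix_vector_mult_diff_distrib matrix_vector_mult_scaleR inner_diff
        v_def[symmetric] q_def power2_eq_square inner_commute algebra_simps)
  ultimately have quadratic: "2 * c * (v \<bullet> v) \<le> c\<^sup>2 * q" for c
    by (metis diff_ge_0_iff_ge)
  have "q \<ge> 0" unfolding q_def by (rule psd)
  have "v \<bullet> v = 0"
  proof (rule ccontr)
    assume "v \<bullet> v \<noteq> 0"
    then have pos: "v \<bullet> v > 0" by simp
    \<comment> \<open>Small enough that \<open>c * q\<close> is at most
      \<open>v \<bullet> v\<close>; the \<open>+ 1\<close> avoids division by zero.\<close>
    define c where "c = (v \<bullet> v) / (q + 1)"
    have "c > 0" using pos \<open>q \<ge> 0\<close> by (simp add: c_def)
    have "c * (2 * (v \<bullet> v)) \<le> c * (c * q)"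
      using quadratic[of c] by (simp add: power2_eq_square ac_simps)
    then have "2 * (v \<bullet> v) \<le> c * q"
      using \<open>c > 0\<close> by simp
    also have "\<dots> \<le> v \<bullet> v"
      using pos \<open>q \<ge> 0\<close> by (simp add: c_def field_simps)
    finally show False using pos by simp
  qed
  then have "J *v y = 0" by (simp add: v_def)
  then have "matrix_inv J *v (J *v y) = 0" by simp
  then show False
    using y by (simp add: matrix_vector_mul_assoc matrix_inv[OF inv])
qed

section \<open>Local asymptotic normality with a vanishing score\<close>

theorem theorem2:
  fixes \<mu> :: "'x measure"
    and p D1 D2 :: "'x \<Rightarrow> real \<Rightarrow> real^'p::finite \<Rightarrow> real"
    and G :: "'x \<Rightarrow> real \<Rightarrow> real^'p \<Rightarrow> real^'p"
    and \<Xi> :: "real set" and \<Theta> :: "(real^'p) set"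
    and \<xi>0 :: real and \<theta> :: "real^'p"
    and \<delta>1 :: "real^('p option) \<Rightarrow> real"
    and p0 d2 :: "'x \<Rightarrow> real" and g :: "'x \<Rightarrow> real^'p"
    and P0 :: "'x measure"
    and H :: "(real^('p option)) set"
    and E :: "nat \<Rightarrow> real^('p option) \<Rightarrow> (nat \<Rightarrow> 'x) measure"
    and P0n :: "nat \<Rightarrow> (nat \<Rightarrow> 'x) measure"
    and S\<xi> :: "nat \<Rightarrow> (nat \<Rightarrow> 'x) \<Rightarrow> real"
    and S\<theta> :: "nat \<Rightarrow> (nat \<Rightarrow> 'x) \<Rightarrow> real^'p"
    and S :: "nat \<Rightarrow> (nat \<Rightarrow> 'x) \<Rightarrow> real^('p option)"
    and J :: "real^('p option)^('p option)"
    and Z :: "nat \<Rightarrow> (nat \<Rightarrow> 'x) \<Rightarrow> real"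
  assumes xi0: "\<xi>0 \<in> interior \<Xi>" and theta: "\<theta> \<in> interior \<Theta>"
    and density_measurable:
      "\<And>\<xi> \<eta>. \<xi> \<in> \<Xi> \<Longrightarrow> \<eta> \<in> \<Theta> \<Longrightarrow> (\<lambda>x. p x \<xi> \<eta>) \<in> borel_measurable \<mu>"
    and density_nonneg:
      "\<And>\<xi> \<eta> x. \<xi> \<in> \<Xi> \<Longrightarrow> \<eta> \<in> \<Theta> \<Longrightarrow> x \<in> space \<mu> \<Longrightarrow> 0 \<le> p x \<xi> \<eta>"
    and density_prob:
      "\<And>\<xi> \<eta>. \<xi> \<in> \<Xi> \<Longrightarrow> \<eta> \<in> \<Theta> \<Longrightarrow> prob_space (density \<mu> (\<lambda>x. ennreal (p x \<xi> \<eta>)))"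
    and C2_in_xi:
      "AE x in \<mu>. \<forall>\<xi>\<in>interior \<Xi>. \<forall>\<eta>\<in>interior \<Theta>.
         ((\<lambda>s. p x s \<eta>) has_real_derivative D1 x \<xi> \<eta>) (at \<xi>) \<and>
         ((\<lambda>s. D1 x s \<eta>) has_real_derivative D2 x \<xi> \<eta>) (at \<xi>) \<and>
         isCont (\<lambda>s. D2 x s \<eta>) \<xi>"
    and C1_in_theta:
      "AE x in \<mu>. \<forall>\<xi>\<in>interior \<Xi>. \<forall>\<eta>\<in>interior \<Theta>.
         (GDERIV (\<lambda>s. p x \<xi> s) \<eta> :> G x \<xi> \<eta>) \<and> isCont (\<lambda>s. G x \<xi> s) \<eta>"
    and null_point: "p0 = (\<lambda>x. p x \<xi>0 \<theta>)" "d2 = (\<lambda>x. D2 x \<xi>0 \<theta>)" "g = (\<lambda>x. G x \<xi>0 \<theta>)"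
    and null_law: "P0 = density \<mu> (\<lambda>x. ennreal (p0 x))"
    and derivs_measurable: "d2 \<in> borel_measurable \<mu>" "g \<in> borel_measurable \<mu>"
    and first_deriv_vanishes: "AE x in P0. D1 x \<xi>0 \<theta> = 0"
    and second_deriv_nonzero: "measure P0 {x \<in> space P0. d2 x \<noteq> 0} > 0"
    and second_deriv_nondegenerate:
      "\<And>a. measure P0 {x \<in> space P0. d2 x \<noteq> a \<bullet> g x} > 0"
    and J: "J = info_matrix \<mu> p0 d2 g"
    and J_exists:
      "integrable \<mu> (\<lambda>x. (v_xi p0 d2 x)\<^sup>2)" "\<And>i. integrable \<mu> (\<lambda>x. (v_theta p0 g x $ i)\<^sup>2)"
    and J_nonsingular: "invertible J"
    and H: "H = {t. 0 \<le> t $ None}"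
    and delta1: "\<And>t. t \<in> H \<Longrightarrow> (\<delta>1 t)\<^sup>2 = t $ None"
    and E: "E = (\<lambda>n t. sample_law \<mu> p n
                  (\<xi>0 + \<delta>1 t * real n powr (-1/4))
                  (\<theta> + (real n powr (-1/2)) *\<^sub>R nuisance_part t))"
    and P0n: "P0n = (\<lambda>n. sample_law \<mu> p n \<xi>0 \<theta>)"
    and S_xi: "S\<xi> = score_xi p0 d2" and S_theta: "S\<theta> = score_theta p0 g"
    and S: "S = (\<lambda>n X. block_vec (S\<xi> n X) (S\<theta> n X))"
    and expansion:
      "\<And>t. t \<in> H \<Longrightarrow> small_o_P_one P0n
         (\<lambda>n X. log_ext (likelihood_ratio (P0n n) (E n t) X)
                - ereal (t \<bullet> S n X - 1/2 * (t \<bullet> (J *v t))))"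
    and score_clt: "conv_in_distr P0n S (mv_normal 0 J) (\<lambda>y. y)"
    and Z: "Z = (\<lambda>n X. efficient_score_stat J (S\<xi> n X) (S\<theta> n X))"
  shows
    "experiments_converge H E (gaussian_shift J) \<and>
     (\<forall>\<alpha>. 0 < \<alpha> \<and> \<alpha> < 1 \<longrightarrow>
        ump_test (gaussian_shift J) {t \<in> H. \<delta>1 t = 0} {t \<in> H. \<delta>1 t \<noteq> 0} \<alpha>
          (indicator {y. y $ None \<ge> normal_quantile (1 - \<alpha>) * efficient_info J powr (-1/2)})) \<and>
     (\<forall>t\<in>H. weak_conv_m
        (\<lambda>n. distr (E n t) borel (Z n))
        (distr (gaussian_shift J t) borel (\<lambda>y. efficient_info J powr (1/2) * y $ None)))"
proof -
  have xi0_in: "\<xi>0 \<in> \<Xi>" and theta_in: "\<theta> \<in> \<Theta>"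
    using xi0 theta interior_subset by blast+
  have [measurable]: "p0 \<in> borel_measurable \<mu>" "d2 \<in> borel_measurable \<mu>" "g \<in> borel_measurable \<mu>"
    using density_measurable[OF xi0_in theta_in] derivs_measurable by (simp_all add: null_point)
  note v_meas = borel_measurable_v[OF \<open>p0 \<in> borel_measurable \<mu>\<close> \<open>d2 \<in> borel_measurable \<mu>\<close> \<open>g \<in> borel_measurable \<mu>\<close>]
  have prob_sample: "prob_space (sample_law \<mu> p n \<xi> \<eta>)" if "\<xi> \<in> \<Xi>" "\<eta> \<in> \<Theta>" for n \<xi> \<eta>
    unfolding sample_law_def by (intro prob_space_PiM density_prob that)
  have sets_sample: "sets (sample_law \<mu> p n \<xi> \<eta>) = sets (\<Pi>\<^sub>M i\<in>{..<n}. \<mu>)" for n \<xi> \<eta>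
    unfolding sample_law_def by (intro sets_PiM_cong) auto
  have prob_P0n: "prob_space (P0n n)" for n
    unfolding P0n by (intro prob_sample xi0_in theta_in)
  have sets_E: "sets (E n t) = sets (P0n n)" for n t
    unfolding E P0n by (simp add: sets_sample)
  \<comment> \<open>Only eventual: both local parameters converge to interior points and so end up
    inside the parameter sets.\<close>
  have prob_E: "\<forall>\<^sub>F n in sequentially. prob_space (E n t)" for t
  proof -
    have powr_null: "(\<lambda>n. real n powr s) \<longlonglongrightarrow> 0" if "s < 0" for s
      by (rule tendsto_neg_powr[OF that filterlim_real_sequentially])
    have "(\<lambda>n. \<xi>0 + \<delta>1 t * real n powr (-1/4)) \<longlonglongrightarrow> \<xi>0 + \<delta>1 t * 0"
      by (intro tendsto_add tendsto_mult tendsto_const powr_null) simp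
    then have "\<forall>\<^sub>F n in sequentially. \<xi>0 + \<delta>1 t * real n powr (-1/4) \<in> interior \<Xi>"
      by (rule topological_tendstoD) (use xi0 in auto)
    moreover have "(\<lambda>n. \<theta> + (real n powr (-1/2)) *\<^sub>R nuisance_part t) \<longlonglongrightarrow> \<theta> + 0 *\<^sub>R nuisance_part t"
      by (intro tendsto_add tendsto_scaleR tendsto_const powr_null) simp
    then have "\<forall>\<^sub>F n in sequentially. \<theta> + (real n powr (-1/2)) *\<^sub>R nuisance_part t \<in> interior \<Theta>"
      by (rule topological_tendstoD) (use theta in auto)
    ultimately show ?thesis
      by eventually_elim (auto simp: E intro!: prob_sample interior_subset[THEN subsetD])
  qed
  have S_meas: "S n \<in> borel_measurable (P0n n)" for n
  proof -
    have sets_P0n: "sets (P0n n) = sets (\<Pi>\<^sub>M i\<in>{..<n}. \<mu>)"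
      by (simp add: P0n sets_sample)
    have coord: "(\<lambda>X. X i) \<in> P0n n \<rightarrow>\<^sub>M \<mu>" if "i < n" for i
      unfolding measurable_cong_sets[OF sets_P0n refl] using that
      by (intro measurable_component_singleton) simp
    note [measurable] = v_meas
    have "S\<xi> n \<in> borel_measurable (P0n n)"
    proof -
      have "(\<lambda>x. v_xi p0 d2 x / sqrt (p0 x)) \<in> borel_measurable \<mu>"
        by measurable
      then have "(\<lambda>X. \<Sum>i<n. v_xi p0 d2 (X i) / sqrt (p0 (X i))) \<in> borel_measurable (P0n n)"
        by (intro borel_measurable_sum) (rule measurable_compose[OF coord], auto)
      then show ?thesis
        unfolding S_xi score_xi_def[abs_def] by measurable
    qed
    moreover have "S\<theta> n \<in> borel_measurable (P0n n)"
    proof -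
      have "(\<lambda>x. (1 / sqrt (p0 x)) *\<^sub>R v_theta p0 g x) \<in> borel_measurable \<mu>"
        by measurable
      then have "(\<lambda>X. \<Sum>i<n. (1 / sqrt (p0 (X i))) *\<^sub>R v_theta p0 g (X i)) \<in> borel_measurable (P0n n)"
        by (intro borel_measurable_sum) (rule measurable_compose[OF coord], auto)
      then show ?thesis
        unfolding S_theta score_theta_def[abs_def] by measurable
    qed
    ultimately show ?thesis
      unfolding S by (rule borel_measurable_block_vec)
  qed
  have bilinear: "y \<bullet> (J *v z) = 4 * (\<integral>x. (y \<bullet> block_vec (v_xi p0 d2 x) (v_theta p0 g x)) *
      (z \<bullet> block_vec (v_xi p0 d2 x) (v_theta p0 g x)) \<partial>\<mu>)" for y z
    unfolding J by (rule info_matrix_bilinear[OF v_meas J_exists])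
  have sym: "transpose J = J"
    by (simp add: J info_matrix_def transpose_def vec_eq_iff mult.commute)
  have pd: "0 < y \<bullet> (J *v y)" if "y \<noteq> 0" for y
    by (rule positive_definite_if_invertible[OF sym J_nonsingular _ that])
       (simp add: bilinear)
  text \<open>Testing the convergence of the scores with a constant shows that the limit has mass one.\<close>
  have "(\<lambda>n. measure (P0n n) (space (P0n n))) \<longlonglongrightarrow> measure (mv_normal 0 J) (space (mv_normal 0 J))"
    using score_clt[unfolded conv_in_distr_def, rule_format, of "\<lambda>_. 1"] by simp
  then have "measure (mv_normal 0 J) (space (mv_normal 0 J)) = 1"
    by (simp add: prob_space.prob_space[OF prob_P0n] LIMSEQ_const_iff)
  \<comment> \<open>An infinite total mass would have \<open>measure\<close> equal to 0, so the
    value one also proves finiteness.\<close>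
  then have "emeasure (mv_normal 0 J) (space (mv_normal 0 J)) = 1"
    by (metis emeasure_eq_ennreal_measure ennreal_1 measure_def enn2real_top zero_neq_one)
  then have prob_normal: "prob_space (mv_normal 0 J)"
    by (rule prob_spaceI)
  interpret G: gaussian_shift_experiment J
    by (rule gaussian_shift_experiment.intro) (fact sym J_nonsingular prob_normal)+
  interpret L: log_likelihood_expansion H P0n E S G.loglik "mv_normal 0 J"
  proof (rule log_likelihood_expansion.intro)
    show "\<forall>\<^sub>F n in sequentially. prob_space (P0n n)" by (simp add: prob_P0n)
    show "\<forall>\<^sub>F n in sequentially. prob_space (E n h) \<and> sets (E n h) = sets (P0n n)" for h
      using prob_E[of h] by eventually_elim (simp add: sets_E)
    show "\<forall>\<^sub>F n in sequentially. S n \<in> borel_measurable (P0n n)" by (simp add: S_meas)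
    show "continuous_on UNIV (G.loglik h)" for h
      unfolding G.loglik_def by (intro continuous_intros)
    show "small_o_P_one P0n (\<lambda>n x. log_ext (likelihood_ratio (P0n n) (E n h) x) - ereal (G.loglik h (S n x)))"
      if "h \<in> H" for h
      using expansion[OF that] by (simp add: G.loglik_def)
  qed (rule score_clt prob_normal G.sets_mv_normal G.mass_loglik)+
  define \<kappa> where "\<kappa> = efficient_info J"
  define w where "w = efficient_direction J"
  have \<kappa>: "\<kappa> > 0"
    unfolding \<kappa>_def by (rule efficient_info_pos[OF sym pd])
  have w: "J *v w = \<kappa> *\<^sub>R axis None 1" "w $ None = 1"
    unfolding \<kappa>_def w_def by (rule mult_efficient_direction[OF sym pd]) (simp_all add: efficient_direction_def)
  have "experiments_converge H E (gaussian_shift J)"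
    unfolding experiments_converge_def conv_in_distr_def
  proof (intro allI impI)
    fix I h0 and f :: "(real^('p option) \<Rightarrow> real) \<Rightarrow> real"
    assume "finite I \<and> I \<subseteq> H \<and> h0 \<in> H" and f: "continuous_on UNIV f \<and> bounded (range f)"
    then have I: "finite I" "I \<subseteq> H" "h0 \<in> H" by auto
    obtain C where C: "\<And>z. \<bar>f z\<bar> \<le> C"
      using f by (auto simp: bounded_iff)
    let ?\<Phi> = "\<lambda>z :: (real^('p option) \<Rightarrow> real) \<times> (real^('p option)). f (fst z)"
    have \<Phi>: "continuous_on UNIV ?\<Phi>"
      by (rule continuous_on_compose2[of UNIV f]) (use f in \<open>auto intro: continuous_intros\<close>)
    have r_meas: "(\<lambda>y. exp (G.loglik h (J *v y) - G.loglik h0 (J *v y))) \<in> borel_measurable borel" for h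
      by measurable
    have F_meas: "(\<lambda>y. f (\<lambda>h\<in>I. exp (G.loglik h (J *v y) - G.loglik h0 (J *v y)))) \<in> borel_measurable borel"
      using borel_measurable_continuous_process[OF \<Phi> I(1) r_meas, of "\<lambda>y. y"] by simp
    have LR_meas: "likelihood_ratio (gaussian_shift J h0) (gaussian_shift J h) \<in> borel_measurable borel" for h
      using likelihood_ratio[of "gaussian_shift J h0" "gaussian_shift J h"]
      by (simp add: is_likelihood_ratio_def prob_space.finite_measure G.prob_space_gaussian_shift
          cong: measurable_cong_sets)
    have LR_F_meas: "(\<lambda>y. f (\<lambda>h\<in>I. likelihood_ratio (gaussian_shift J h0) (gaussian_shift J h) y)) \<in> borel_measurable borel"
      using borel_measurable_continuous_process[OF \<Phi> I(1) LR_meas, of "\<lambda>y. y"] by simp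
    have "(\<lambda>n. \<integral>x. f (\<lambda>h\<in>I. likelihood_ratio (E n h0) (E n h) x) \<partial>E n h0)
        \<longlonglongrightarrow> (\<integral>s. f (\<lambda>h\<in>I. exp (G.loglik h s - G.loglik h0 s)) * exp (G.loglik h0 s) \<partial>mv_normal 0 J)"
      using L.le_cam_third[OF I \<Phi>, of C] C by simp
    also have "(\<integral>s. f (\<lambda>h\<in>I. exp (G.loglik h s - G.loglik h0 s)) * exp (G.loglik h0 s) \<partial>mv_normal 0 J)
        = (\<integral>y. f (\<lambda>h\<in>I. exp (G.loglik h (J *v y) - G.loglik h0 (J *v y))) \<partial>gaussian_shift J h0)"
      by (simp add: G.integral_gaussian_shift[OF F_meas])
    \<comment> \<open>The chosen witness agrees with the explicit ratio only almost everywhere;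
      finiteness of \<open>I\<close> gives one exceptional set.\<close>
    also have "\<dots> = (\<integral>y. f (\<lambda>h\<in>I. likelihood_ratio (gaussian_shift J h0) (gaussian_shift J h) y) \<partial>gaussian_shift J h0)"
    proof (rule integral_cong_AE)
      have "AE y in gaussian_shift J h0. \<forall>h\<in>I. likelihood_ratio (gaussian_shift J h0) (gaussian_shift J h) y
          = exp (G.loglik h (J *v y) - G.loglik h0 (J *v y))"
        by (intro AE_finite_allI I G.likelihood_ratio_gaussian_shift)
      then show "AE y in gaussian_shift J h0. f (\<lambda>h\<in>I. exp (G.loglik h (J *v y) - G.loglik h0 (J *v y)))
          = f (\<lambda>h\<in>I. likelihood_ratio (gaussian_shift J h0) (gaussian_shift J h) y)"
        by eventually_elim (auto intro!: arg_cong[where f=f] restrict_ext)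
    qed (use F_meas LR_F_meas in \<open>simp_all cong: measurable_cong_sets\<close>)
    finally show "(\<lambda>n. \<integral>x. f (\<lambda>h\<in>I. likelihood_ratio (E n h0) (E n h) x) \<partial>E n h0)
        \<longlonglongrightarrow> (\<integral>y. f (\<lambda>h\<in>I. likelihood_ratio (gaussian_shift J h0) (gaussian_shift J h) y) \<partial>gaussian_shift J h0)" .
  qed
  moreover have "ump_test (gaussian_shift J) {t \<in> H. \<delta>1 t = 0} {t \<in> H. \<delta>1 t \<noteq> 0} \<alpha>
      (indicator {y. y $ None \<ge> normal_quantile (1 - \<alpha>) * efficient_info J powr (-1/2)})"
    if "0 < \<alpha>" "\<alpha> < 1" for \<alpha>
  proof -
    \<comment> \<open>Either root gives the same hypotheses: in terms of \<open>t\<close>, the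
      two-sided alternative for \<open>\<delta>1\<close> is the one-sided
      \<open>0 < t $ None\<close>.\<close>
    have delta_iff: "\<delta>1 t = 0 \<longleftrightarrow> t $ None = 0" if "t \<in> H" for t
      using delta1[OF that] by (metis power2_eq_iff_nonneg power_zero_numeral zero_eq_power2)
    have "{t \<in> H. \<delta>1 t = 0} = {t. t $ None = 0}" "{t \<in> H. \<delta>1 t \<noteq> 0} = {t. 0 < t $ None}"
      using delta_iff by (auto simp: H less_le)
    then show ?thesis
      using G.ump_half_space_test[OF w \<kappa> that] by (simp only: \<kappa>_def)
  qed
  moreover have "weak_conv_m (\<lambda>n. distr (E n t) borel (Z n))
      (distr (gaussian_shift J t) borel (\<lambda>y. efficient_info J powr (1/2) * y $ None))" if t: "t \<in> H" for t
  proof -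
    define c where "c = efficient_info J powr (1/2)"
    define M where "M = distr (gaussian_shift J t) borel (\<lambda>y. c * y $ None)"
    have Z_eq: "Z n X = c * (matrix_inv J *v S n X) $ None" for n X
    proof -
      have "nuisance_part (S n X) = S\<theta> n X"
        by (simp add: S nuisance_part_def vec_eq_iff)
      then show ?thesis
        using efficient_score_stat_eq[OF sym pd J_nonsingular, of "S n X"] by (simp add: Z S c_def)
    qed
    have [measurable]: "(\<lambda>s. c * (matrix_inv J *v s) $ None) \<in> borel_measurable borel"
      by measurable
    have Z_meas: "Z n \<in> borel_measurable (E n t)" for n
    proof -
      have "S n \<in> borel_measurable (E n t)"
        using S_meas[of n] by (simp add: sets_E cong: measurable_cong_sets)
      then show ?thesis
        unfolding Z_eq[abs_def] by measurable
    qed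
    have M: "real_distribution M"
      unfolding M_def by (intro prob_space.real_distribution_distr G.prob_space_gaussian_shift) measurable
    obtain N where N: "\<And>n. n \<ge> N \<Longrightarrow> prob_space (E n t)"
      using prob_E[of t] by (auto simp: eventually_sequentially)
    \<comment> \<open>The early laws need not be probability measures; they are replaced by the
      limit \<open>M\<close>, which leaves the limits of the distribution functions
      unchanged.\<close>
    define M' where "M' n = (if n \<ge> N then distr (E n t) borel (Z n) else M)" for n
    have M': "real_distribution (M' n)" for n
      unfolding M'_def using M by (auto intro!: prob_space.real_distribution_distr N Z_meas)
    have "weak_conv_m M' M"
    proof (rule integral_bdd_continuous_conv_imp_weak_conv[OF M' M])
      fix f :: "real \<Rightarrow> real" assume f: "\<And>x. isCont f x" "\<And>x. \<bar>f x\<bar> \<le> 1"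
      then have f_cont: "continuous_on UNIV f"
        by (simp add: continuous_at_imp_continuous_on)
      then have [measurable]: "f \<in> borel_measurable borel"
        by (rule borel_measurable_continuous_onI)
      have "continuous_on UNIV (\<lambda>z :: (real^('p option) \<Rightarrow> real) \<times> (real^('p option)). f (c * (matrix_inv J *v snd z) $ None))"
        by (rule continuous_on_compose2[OF f_cont])
           (auto intro!: continuous_intros continuous_on_compose2[OF matrix_vector_mult_linear_continuous_on])
      then have "(\<lambda>n. \<integral>X. f (Z n X) \<partial>E n t)
          \<longlonglongrightarrow> (\<integral>s. f (c * (matrix_inv J *v s) $ None) * exp (G.loglik t s) \<partial>mv_normal 0 J)"
        using L.le_cam_third[of "{}" t "\<lambda>z. f (c * (matrix_inv J *v snd z) $ None)" 1] f(2) t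
        by (simp add: Z_eq)
      also have "(\<integral>s. f (c * (matrix_inv J *v s) $ None) * exp (G.loglik t s) \<partial>mv_normal 0 J) = (\<integral>x. f x \<partial>M)"
        unfolding M_def by (subst integral_distr) (auto simp: G.integral_gaussian_shift)
      finally have lim: "(\<lambda>n. \<integral>X. f (Z n X) \<partial>E n t) \<longlonglongrightarrow> (\<integral>x. f x \<partial>M)" .
      show "(\<lambda>n. \<integral>x. f x \<partial>M' n) \<longlonglongrightarrow> (\<integral>x. f x \<partial>M)"
      proof (rule Lim_transform_eventually[OF lim])
        show "\<forall>\<^sub>F n in sequentially. (\<integral>X. f (Z n X) \<partial>E n t) = (\<integral>x. f x \<partial>M' n)"
          using eventually_ge_at_top[of N] by eventually_elim (simp add: M'_def integral_distr Z_meas)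
      qed
    qed
    moreover have "\<forall>\<^sub>F n in sequentially. cdf (M' n) x = cdf (distr (E n t) borel (Z n)) x" for x
      using eventually_ge_at_top[of N] by eventually_elim (simp add: M'_def)
    ultimately have "weak_conv_m (\<lambda>n. distr (E n t) borel (Z n)) M"
      unfolding weak_conv_m_def weak_conv_def by (blast intro: Lim_transform_eventually)
    then show ?thesis
      by (simp only: M_def c_def)
  qed
  ultimately show ?thesis
    by blast
qed

end
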